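(* Let $N$ be a finite non-empty set. Given a supermodular game $w\in\lozenge(N)$, each of the following mathematical objects uniquely characterizes the face $\mathsf{F}(w)$ of the cone $\lozenge(N)$ generated by $w$ (the smallest face containing $w$): (a) the independence structure $\mathcal{I}(w)$; (b) the subgraph $G(w)$ of the permutohedral graph; (c) the partition $\mathbf{\Upsilon}(w)$ of $\Upsilon(N)$; (d) the fan of posets $\mathfrak{F}(w)$ induced by $w$; (e) the tightness structure $\mathbb{T}(w)$ induced by $w$; (f) the normal fan $\mathcal{N}_{C(w)}$ of the core polytope $C(w)$. That is, for all $m,r\in\lozenge(N)$ and each object $\mathcal{O}(\cdot)$ among (a)–(f), one has $\mathsf{F}(m)=\mathsf{F}(r)$ if and only if $\mathcal{O}(m)=\mathcal{O}(r)$.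
   Context: $N$ is a finite non-empty set, $n=|N|$, $\mathcal{P}(N)$ its power set, $[n]=\{1,\dots,n\}$. An enumeration of $N$ is a bijection $\varepsilon:[n]\to N$; $\Upsilon(N)$ is the set of enumerations; $\varepsilon_{-1}:N\to[n]$ is the inverse of $\varepsilon$. Write $u\preceq_\varepsilon v$ if $\varepsilon_{-1}(u)\le\varepsilon_{-1}(v)$. A game over $N$ is a function $w:\mathcal{P}(N)\to\mathbb{R}$ with $w(\emptyset)=0$; it is supermodular if $w(D\cup E)+w(D\cap E)\ge w(D)+w(E)$ for all $D,E\subseteq N$. $\lozenge(N)\subseteq\mathbb{R}^{\mathcal{P}(N)}$ is the polyhedral cone of supermodular games over $N$. The core of $w\in\lozenge(N)$ is the polytope $C(w)=\{z\in\mathbb{R}^N:\sum_{\ell\in N}z_\ell=w(N),\ \sum_{\ell\in S}z_\ell\ge w(S)\ \forall S\subseteq N\}$; $\mathrm{ext}(P)$ denotes the set of vertices of a polytope $P$. For a non-empty polytope $P\subseteq\mathbb{R}^N$ and $y\in P$, the outer normal cone is $\mathsf{N}_P(y)=\{x\in\mathbb{R}^N:\langle x,y-z\rangle\ge0\ \forall z\in P\}$, and the normal fan is $\mathcal{N}_P=\{\mathsf{N}_P(y):y\in P\}$. The marginal vector of a game $w$ at $\varepsilon\in\Upsilon(N)$ is $\varphi^w(\varepsilon)\in\mathbb{R}^N$ with $\varphi^w(\varepsilon)_{\varepsilon(i)}=w(\{\varepsilon(1),\dots,\varepsilon(i)\})-w(\{\varepsilon(1),\dots,\varepsilon(i-1)\})$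 for $i\in[n]$; $\varphi^w_{-1}(\{y\})=\{\varepsilon\in\Upsilon(N):\varphi^w(\varepsilon)=y\}$. The tightness class is $\mathcal{T}^w_y=\{S\subseteq N:\sum_{\ell\in S}y_\ell=w(S)\}$. For $S\subseteq\Upsilon(N)$ put $S^{\rhd}=\{(u,v)\in N\times N:u\preceq_\varepsilon v\ \forall\varepsilon\in S\}$. $\mathcal{E}(N)$ is the set of elementary triplets $(a,b|C)$ with $a,b\in N$ distinct and $C\subseteq N\setminus\{a,b\}$, and $\Delta w(a,b|C)=w(C\cup\{a,b\})+w(C)-w(C\cup\{a\})-w(C\cup\{b\})$. For $w\in\lozenge(N)$ define: - enumeration partition $\mathbf{\Upsilon}(w)=\{\varphi^w_{-1}(\{y\}):y\in\mathrm{ext}(C(w))\}$ (a partition of $\Upsilon(N)$); - fan of posets $\mathfrak{F}(w)=\{(\varphi^w_{-1}(\{y\}))^{\rhd}:y\in\mathrm{ext}(C(w))\}$; - tightness structure $\mathbb{T}(w)=\{\mathcal{T}^w_y:y\in\mathrm{ext}(C(w))\}$; - independence structure $\mathcal{I}(w)=\{(a,b|C)\in\mathcal{E}(N):\Delta w(a,b|C)=0\}$; - permutohedral subgraph $G(w)$: the undirected graph with node set $\Upsilon(N)$ in which $\varepsilon,\eta$ are adjacent iff there is $1\le i<n$ with $\varepsilon(i)=\eta(i+1)$, $\varepsilon(i+1)=\eta(i)$, $\varepsilon(k)=\eta(k)$ for $k\ne i,i+1$, and $\Delta w(\varepsilon(i),\varepsilon(i+1)\,|\,\{\varepsilon(j):j<i\})=0$.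 *)

theory Defs
  imports "HOL-Analysis.Analysis"
begin

text \<open>
  The finite non-empty set \<open>N\<close> is the universe of a type \<open>'n\<close> of class \<open>finite\<close>, so that
  \<open>real ^ 'n\<close> is the space of real vectors indexed by \<open>N\<close> and \<open>real ^ ('n set)\<close> is the space
  of real functions on the power set of \<open>N\<close>.
\<close>

definition supermodular_cone :: "(real ^ ('n::finite set)) set" where
  "supermodular_cone =
     {w. w $ {} = 0 \<and> (\<forall>D E. w $ (D \<union> E) + w $ (D \<inter> E) \<ge> w $ D + w $ E)}"

definition generated_face :: "'a::real_vector set \<Rightarrow> 'a \<Rightarrow> 'a set" where
  "generated_face K x = \<Inter>{F. F face_of K \<and> x \<in> F}"

lemma convex_supermodular_cone: "convex (supermodular_cone :: (real ^ ('n::finite set)) set)"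
proof (rule convexI)
  fix x y :: "real ^ ('n::finite set)" and u v :: real
  assume x: "x \<in> supermodular_cone" and y: "y \<in> supermodular_cone"
    and uv: "0 \<le> u" "0 \<le> v" "u + v = 1"
  have "u * x $ D + v * y $ D + (u * x $ E + v * y $ E)
    \<le> u * x $ (D \<union> E) + v * y $ (D \<union> E) + (u * x $ (D \<inter> E) + v * y $ (D \<inter> E))" for D E
  proof -
    have "u * (x $ D + x $ E) \<le> u * (x $ (D \<union> E) + x $ (D \<inter> E))"
      using x uv by (intro mult_left_mono) (auto simp: supermodular_cone_def)
    moreover have "v * (y $ D + y $ E) \<le> v * (y $ (D \<union> E) + y $ (D \<inter> E))"
      using y uv by (intro mult_left_mono) (auto simp: supermodular_cone_def)
    ultimately show ?thesis
      by (simp add: distrib_left)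
  qed
  with x y show "u *\<^sub>R x + v *\<^sub>R y \<in> supermodular_cone"
    by (simp add: supermodular_cone_def)
qed

text \<open>The intersection of all faces containing a point is itself a face, hence the smallest one.\<close>

lemma generated_face_smallest:
  assumes "convex K" "x \<in> K"
  shows "generated_face K x face_of K" "x \<in> generated_face K x"
    "\<And>F. F face_of K \<Longrightarrow> x \<in> F \<Longrightarrow> generated_face K x \<subseteq> F"
proof -
  have "K \<in> {F. F face_of K \<and> x \<in> F}"
    using assms by (simp add: face_of_refl)
  then show "generated_face K x face_of K"
    unfolding generated_face_def by (intro face_of_Inter) auto
qed (auto simp: generated_face_def)

definition core :: "real ^ ('n::finite set) \<Rightarrow> (real ^ 'n) set" where
  "core w = {z. (\<Sum>l\<in>UNIV. z $ l) = w $ UNIV \<and> (\<forall>S. (\<Sum>l\<in>S. z $ l) \<ge> w $ S)}"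

definition vertices :: "'a::real_vector set \<Rightarrow> 'a set" where
  "vertices P = {y. y extreme_point_of P}"

definition normal_cone :: "'a::real_inner set \<Rightarrow> 'a \<Rightarrow> 'a set" where
  "normal_cone P y = {x. \<forall>z\<in>P. x \<bullet> (y - z) \<ge> 0}"

definition normal_fan :: "'a::real_inner set \<Rightarrow> 'a set set" where
  "normal_fan P = {normal_cone P y | y. y \<in> P}"

text \<open>
  Enumerations are made extensional (undefined outside \<open>{1..n}\<close>), so that equality of
  enumerations is equality on \<open>{1..n}\<close>.
\<close>

definition enumerations :: "(nat \<Rightarrow> 'n::finite) set" where
  "enumerations = {\<epsilon>. \<epsilon> \<in> extensional {1..CARD('n)} \<and> bij_betw \<epsilon> {1..CARD('n)} UNIV}"

definition position :: "(nat \<Rightarrow> 'n::finite) \<Rightarrow> 'n \<Rightarrow> nat" where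
  "position \<epsilon> = inv_into {1..CARD('n)} \<epsilon>"

definition marginal_vector :: "real ^ ('n::finite set) \<Rightarrow> (nat \<Rightarrow> 'n) \<Rightarrow> real ^ 'n" where
  "marginal_vector w \<epsilon> =
     (\<chi> u. w $ (\<epsilon> ` {1..position \<epsilon> u}) - w $ (\<epsilon> ` {1..<position \<epsilon> u}))"

definition marginal_fibre :: "real ^ ('n::finite set) \<Rightarrow> real ^ 'n \<Rightarrow> (nat \<Rightarrow> 'n) set" where
  "marginal_fibre w y = {\<epsilon> \<in> enumerations. marginal_vector w \<epsilon> = y}"

definition tightness_class :: "real ^ ('n::finite set) \<Rightarrow> real ^ 'n \<Rightarrow> 'n set set" where
  "tightness_class w y = {S. (\<Sum>l\<in>S. y $ l) = w $ S}"

definition common_order :: "(nat \<Rightarrow> 'n::finite) set \<Rightarrow> ('n \<times> 'n) set" where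
  "common_order S = {(u, v). \<forall>\<epsilon>\<in>S. position \<epsilon> u \<le> position \<epsilon> v}"

definition elementary_triplets :: "('n::finite \<times> 'n \<times> 'n set) set" where
  "elementary_triplets = {(a, b, C). a \<noteq> b \<and> C \<subseteq> UNIV - {a, b}}"

definition supermodular_difference ::
    "real ^ ('n::finite set) \<Rightarrow> 'n \<Rightarrow> 'n \<Rightarrow> 'n set \<Rightarrow> real" where
  "supermodular_difference w a b C =
     w $ (C \<union> {a, b}) + w $ C - w $ (C \<union> {a}) - w $ (C \<union> {b})"

definition enumeration_partition ::
    "real ^ ('n::finite set) \<Rightarrow> (nat \<Rightarrow> 'n) set set" where
  "enumeration_partition w = {marginal_fibre w y | y. y \<in> vertices (core w)}"

definition fan_of_posets :: "real ^ ('n::finite set) \<Rightarrow> ('n \<times> 'n) set set" where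
  "fan_of_posets w = {common_order (marginal_fibre w y) | y. y \<in> vertices (core w)}"

definition tightness_structure :: "real ^ ('n::finite set) \<Rightarrow> 'n set set set" where
  "tightness_structure w = {tightness_class w y | y. y \<in> vertices (core w)}"

definition independence_structure ::
    "real ^ ('n::finite set) \<Rightarrow> ('n \<times> 'n \<times> 'n set) set" where
  "independence_structure w =
     {(a, b, C) \<in> elementary_triplets. supermodular_difference w a b C = 0}"

definition permutohedral_adjacent ::
    "real ^ ('n::finite set) \<Rightarrow> (nat \<Rightarrow> 'n) \<Rightarrow> (nat \<Rightarrow> 'n) \<Rightarrow> bool" where
  "permutohedral_adjacent w \<epsilon> \<eta> \<longleftrightarrow>
     (\<exists>i. 1 \<le> i \<and> i < CARD('n) \<and> \<epsilon> i = \<eta> (i + 1) \<and> \<epsilon> (i + 1) = \<eta> i \<and>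
          (\<forall>k\<in>{1..CARD('n)} - {i, i + 1}. \<epsilon> k = \<eta> k) \<and>
          supermodular_difference w (\<epsilon> i) (\<epsilon> (i + 1)) (\<epsilon> ` {1..<i}) = 0)"

text \<open>
  An undirected graph is the pair of its node set and its set of edges, an edge being an
  unordered pair of nodes.
\<close>

definition permutohedral_subgraph ::
    "real ^ ('n::finite set) \<Rightarrow> (nat \<Rightarrow> 'n) set \<times> (nat \<Rightarrow> 'n) set set" where
  "permutohedral_subgraph w =
     (enumerations,
      {{\<epsilon>, \<eta>} | \<epsilon> \<eta>. \<epsilon> \<in> enumerations \<and> \<eta> \<in> enumerations \<and> permutohedral_adjacent w \<epsilon> \<eta>})"

end

theory Submission
  imports Defs
begin

text \<open>
  A supermodular game \<open>r\<close> lies in the face generated by \<open>m\<close> iff every supermodular inequality tight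
  for \<open>m\<close> is tight for \<open>r\<close>; hence the face and the independence structure determine each other.
  By telescoping, a set is tight at the marginal vector of an enumeration iff certain supermodular
  inequalities are equalities, so the independence structure determines the tightness class of
  each marginal vector. The vertices of the core are the marginal vectors, and two enumerations
  have the same marginal vector iff all prefixes of the one are tight at the marginal vector of the
  other, so everything else is determined as well. Conversely, enumerations that differ by an
  adjacent transposition have the same marginal vector iff the elementary difference at the
  transposition vanishes, so it suffices to recover from each object which of these pairs of
  enumerations have the same marginal vector.
\<close>

subsection \<open>Faces of the supermodular cone\<close>

text \<open>The slack in the inequality for an arbitrary pair of sets; the elementary differences
  are the slacks of pairs that differ by one element on each side.\<close>

definition supermodular_defect :: "real ^ ('n::finite set) \<Rightarrow> 'n set \<Rightarrow> 'n set \<Rightarrow> real" where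
  "supermodular_defect w D E = w $ (D \<union> E) + w $ (D \<inter> E) - w $ D - w $ E"

lemma supermodular_defect_nonneg:
  "w \<in> supermodular_cone \<Longrightarrow> 0 \<le> supermodular_defect w D E"
  unfolding supermodular_cone_def supermodular_defect_def by (auto simp: algebra_simps)

lemma supermodular_cone_iff_defect:
  "w \<in> supermodular_cone \<longleftrightarrow> w $ {} = 0 \<and> (\<forall>D E. 0 \<le> supermodular_defect w D E)"
  unfolding supermodular_cone_def supermodular_defect_def
  by (simp add: diff_diff_eq)

lemma supermodular_cone_empty: "w \<in> supermodular_cone \<Longrightarrow> w $ {} = 0"
  by (simp add: supermodular_cone_def)

lemma supermodular_defect_commute: "supermodular_defect w D E = supermodular_defect w E D"
  by (simp add: supermodular_defect_def Un_commute Int_commute)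

lemma supermodular_defect_subset: "D \<subseteq> E \<Longrightarrow> supermodular_defect w D E = 0"
  by (simp add: supermodular_defect_def Un_absorb1 Int_absorb2)

lemma supermodular_defect_affine:
  "supermodular_defect (a *\<^sub>R v + b *\<^sub>R w) D E =
     a * supermodular_defect v D E + b * supermodular_defect w D E"
  by (simp add: supermodular_defect_def algebra_simps)

text \<open>The values at \<open>D - {a}\<close> and at \<open>(D - {a}) \<union> E\<close> cancel
  in the sum. If \<open>D - E\<close> has at least two elements, both summands belong to pairs with
  smaller differences, which drives the reduction to elementary triplets.\<close>

lemma supermodular_defect_split:
  assumes "a \<in> D" "a \<notin> E"
  shows "supermodular_defect w D E =
    supermodular_defect w (D - {a}) E + supermodular_defect w D ((D - {a}) \<union> E)"
proof -
  have "D \<union> ((D - {a}) \<union> E) = D \<union> E" "D \<inter> ((D - {a}) \<union> E) = D - {a}"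
    "(D - {a}) \<inter> E = D \<inter> E" using assms by auto
  then show ?thesis by (simp add: supermodular_defect_def)
qed

lemma supermodular_difference_eq_defect:
  assumes "a \<noteq> b" "a \<notin> C" "b \<notin> C"
  shows "supermodular_difference w a b C = supermodular_defect w (insert a C) (insert b C)"
proof -
  have "insert a C \<inter> insert b C = C" "insert a C \<union> insert b C = C \<union> {a, b}" using assms by auto
  then show ?thesis by (simp add: supermodular_difference_def supermodular_defect_def)
qed

lemma mem_independence_structure:
  "(a, b, C) \<in> independence_structure w \<longleftrightarrow>
     a \<noteq> b \<and> a \<notin> C \<and> b \<notin> C \<and> supermodular_defect w (insert a C) (insert b C) = 0"
  using supermodular_difference_eq_defect[of a b C w]
  by (cases "a \<noteq> b \<and> a \<notin> C \<and> b \<notin> C")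
    (auto simp: independence_structure_def elementary_triplets_def)

text \<open>
  Every defect is a sum of elementary differences, all of them nonnegative, so it vanishes iff
  they all do.
\<close>

lemma supermodular_defect_zero_mono:
  assumes m: "m \<in> supermodular_cone"
    and sub: "independence_structure m \<subseteq> independence_structure r"
    and "supermodular_defect m D E = 0"
  shows "supermodular_defect r D E = 0"
  using assms(3)
proof (induction "card (D - E) + card (E - D)" arbitrary: D E rule: less_induct)
  case less
  \<comment> \<open>The pair is kept general so that the claim applies to \<open>(D, E)\<close> and
    to \<open>(E, D)\<close>, which have the same measure.\<close>
  have split: "supermodular_defect r D' E' = 0"
    if size: "card (D' - E') + card (E' - D') = card (D - E) + card (E - D)"
      and zero: "supermodular_defect m D' E' = 0" and two: "card (D' - E') \<ge> 2" for D' E'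
  proof -
    have "D' - E' \<noteq> {}" using two by (intro notI) simp
    then obtain a where a: "a \<in> D'" "a \<notin> E'" by blast
    have s: "supermodular_defect w D' E' =
        supermodular_defect w (D' - {a}) E' + supermodular_defect w D' ((D' - {a}) \<union> E')" for w
      using supermodular_defect_split[OF a] .
    \<comment> \<open>Two nonnegative numbers with sum zero both vanish.\<close>
    have "supermodular_defect m (D' - {a}) E' = 0" "supermodular_defect m D' ((D' - {a}) \<union> E') = 0"
      using s[of m] zero supermodular_defect_nonneg[OF m, of "D' - {a}" E']
        supermodular_defect_nonneg[OF m, of D' "(D' - {a}) \<union> E'"] by linarith+
    moreover have "D' - {a} - E' = (D' - E') - {a}" "E' - (D' - {a}) = E' - D'"
      "D' - ((D' - {a}) \<union> E') = {a}" "((D' - {a}) \<union> E') - D' = E' - D'" using a by auto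
    moreover have "card ((D' - E') - {a}) < card (D' - E')"
      using a by (intro card_Diff1_less) auto
    ultimately have "supermodular_defect r (D' - {a}) E' = 0"
      "supermodular_defect r D' ((D' - {a}) \<union> E') = 0"
      using less.hyps[of "D' - {a}" E'] less.hyps[of D' "(D' - {a}) \<union> E'"] size two by auto
    then show ?thesis using s[of r] by simp
  qed
  consider "card (D - E) \<ge> 2" | "card (E - D) \<ge> 2" | "D \<subseteq> E" | "E \<subseteq> D"
    | "card (D - E) = 1" "card (E - D) = 1"
  proof -
    have "D \<subseteq> E \<longleftrightarrow> card (D - E) = 0" "E \<subseteq> D \<longleftrightarrow> card (E - D) = 0" by auto
    then show ?thesis using that by linarith
  qed
  then show ?case
  proof cases
    case 1
    then show ?thesis using split[of D E] less.prems by simp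
  next
    case 2
    then show ?thesis using split[of E D] less.prems by (simp add: supermodular_defect_commute)
  next
    case 3
    then show ?thesis by (rule supermodular_defect_subset)
  next
    case 4
    then show ?thesis
      using supermodular_defect_subset[of E D r] supermodular_defect_commute[of r D E] by simp
  next
    case 5
    then obtain a b where ab: "D - E = {a}" "E - D = {b}" by (metis card_1_singletonE)
    then have D: "insert a (D \<inter> E) = D" and E: "insert b (D \<inter> E) = E"
      and "a \<noteq> b" "a \<notin> D \<inter> E" "b \<notin> D \<inter> E" by auto
    then have "(a, b, D \<inter> E) \<in> independence_structure m"
      unfolding mem_independence_structure D E using less.prems by simp
    with sub have "(a, b, D \<inter> E) \<in> independence_structure r" ..
    then show ?thesis unfolding mem_independence_structure D E by simp
  qed
qed

text \<open>The right-hand side is a face because a defect that vanishes inside a segment of the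
  cone vanishes at both ends. It lies in every face containing \<open>m\<close> because, for
  \<open>w \<noteq> m\<close> in it, the segment from \<open>w\<close> to \<open>m\<close> can be
  prolonged beyond \<open>m\<close> within the cone.\<close>

lemma generated_face_supermodular_cone:
  fixes m :: "real ^ ('n::finite set)"
  assumes m: "m \<in> supermodular_cone"
  shows "generated_face supermodular_cone m =
    {w \<in> supermodular_cone. independence_structure m \<subseteq> independence_structure w}"
    (is "_ = ?F")
proof
  have F: "?F face_of supermodular_cone"
    unfolding face_of_def
  proof (intro conjI ballI impI)
    show "?F \<subseteq> supermodular_cone" by blast
    have aff: "independence_structure m \<subseteq> independence_structure (a *\<^sub>R x + b *\<^sub>R y)"
      if xy: "x \<in> ?F" "y \<in> ?F" for x y a b
    proof (rule subsetI)
      fix t assume t: "t \<in> independence_structure m"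
      obtain u v C where [simp]: "t = (u, v, C)" by (cases t) auto
      from t xy have "t \<in> independence_structure x" "t \<in> independence_structure y" by auto
      then show "t \<in> independence_structure (a *\<^sub>R x + b *\<^sub>R y)"
        by (simp add: mem_independence_structure supermodular_defect_affine)
    qed
    show "convex ?F"
    proof (rule convexI)
      fix x y :: "real ^ 'n set" and a b :: real
      assume "x \<in> ?F" "y \<in> ?F" "0 \<le> a" "0 \<le> b" "a + b = 1"
      then show "a *\<^sub>R x + b *\<^sub>R y \<in> ?F"
        using convexD[OF convex_supermodular_cone, of x y a b] aff[of x y a b] by simp
    qed
    fix x y z assume xy: "x \<in> supermodular_cone" "y \<in> supermodular_cone" and z: "z \<in> ?F"
      and "z \<in> open_segment x y"
    then obtain u where u: "0 < u" "u < 1" and zu: "z = (1 - u) *\<^sub>R x + u *\<^sub>R y"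
      by (auto simp: in_segment)
    have "supermodular_defect x D E = 0 \<and> supermodular_defect y D E = 0"
      if "supermodular_defect z D E = 0" for D E
    proof -
      have "0 \<le> (1 - u) * supermodular_defect x D E" "0 \<le> u * supermodular_defect y D E"
        using u xy by (simp_all add: supermodular_defect_nonneg)
      moreover have "(1 - u) * supermodular_defect x D E + u * supermodular_defect y D E = 0"
        using that unfolding zu supermodular_defect_affine .
      ultimately have "(1 - u) * supermodular_defect x D E = 0" "u * supermodular_defect y D E = 0"
        by linarith+
      then show ?thesis using u by simp
    qed
    then have "independence_structure z \<subseteq> independence_structure x \<inter> independence_structure y"
      by (auto simp: mem_independence_structure)
    then show "x \<in> ?F" "y \<in> ?F" using xy z by auto
  qed
  show "generated_face supermodular_cone m \<subseteq> ?F"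
    using generated_face_smallest(3)[OF convex_supermodular_cone m F] m by simp
next
  show "?F \<subseteq> generated_face supermodular_cone m"
  proof
    fix w assume w: "w \<in> ?F"
    \<comment> \<open>Ratios with denominator zero are 0 by convention, so the sum below bounds the
      ratios of all pairs not tight for \<open>m\<close>; the added 1 makes \<open>M\<close>
      positive.\<close>
    define \<rho> where
      "\<rho> = (\<lambda>p. case p of (D, E) \<Rightarrow> supermodular_defect w D E / supermodular_defect m D E)"
    define M where "M = 1 + (\<Sum>p\<in>UNIV. \<rho> p)"
    have \<rho>: "0 \<le> \<rho> p" for p
      using w m by (auto simp: \<rho>_def supermodular_defect_nonneg split: prod.split)
    then have M: "1 \<le> M" unfolding M_def by (simp add: sum_nonneg)
    have bound: "supermodular_defect w D E \<le> M * supermodular_defect m D E" for D E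
    proof (cases "supermodular_defect m D E = 0")
      case True
      then show ?thesis using supermodular_defect_zero_mono[OF m] w by fastforce
    next
      case False
      then have pos: "0 < supermodular_defect m D E"
        using supermodular_defect_nonneg[OF m, of D E] by simp
      have "\<rho> (D, E) \<le> (\<Sum>p\<in>UNIV. \<rho> p)" using \<rho> by (intro member_le_sum) auto
      then have "\<rho> (D, E) \<le> M" by (simp add: M_def)
      then show ?thesis using pos by (simp add: \<rho>_def pos_divide_le_eq)
    qed
    \<comment> \<open>This is \<open>m + (m - w) / M\<close>, a point beyond \<open>m\<close> on the
      line from \<open>w\<close>; the bound by \<open>M\<close> keeps its defects
      nonnegative.\<close>
    define v where "v = (1 + 1 / M) *\<^sub>R m + (- 1 / M) *\<^sub>R w"
    have v: "v \<in> supermodular_cone"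
      unfolding supermodular_cone_iff_defect
    proof (intro conjI allI)
      show "v $ {} = 0" using m w by (simp add: v_def supermodular_cone_empty)
      fix D E
      have "supermodular_defect w D E / M \<le> supermodular_defect m D E"
        using bound[of D E] M by (simp add: divide_le_eq mult.commute)
      moreover have "0 \<le> supermodular_defect m D E / M"
        using supermodular_defect_nonneg[OF m, of D E] M by simp
      ultimately show "0 \<le> supermodular_defect v D E"
        unfolding v_def supermodular_defect_affine by (simp add: algebra_simps)
    qed
    show "w \<in> generated_face supermodular_cone m"
      unfolding generated_face_def
    proof (rule InterI)
      fix F assume "F \<in> {F. F face_of supermodular_cone \<and> m \<in> F}"
      then have F: "F face_of supermodular_cone" "m \<in> F" by auto
      show "w \<in> F"
      proof (cases "w = m")
        case False
        \<comment> \<open>The weight for which \<open>(1 - u) *\<^sub>R w + u *\<^sub>R v\<close>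
          has coefficient 1 at \<open>m\<close> and 0 at \<open>w\<close>.\<close>
        define u where "u = M / (1 + M)"
        have u: "0 < u" "u < 1" using M by (auto simp: u_def)
        have c: "u * (1 + 1 / M) = 1" "1 - u + u * (- 1 / M) = 0"
          using M unfolding u_def by (simp_all add: divide_simps)
        have "(1 - u) *\<^sub>R w + u *\<^sub>R v =
            (u * (1 + 1 / M)) *\<^sub>R m + (1 - u + u * (- 1 / M)) *\<^sub>R w"
          unfolding v_def scaleR_add_right scaleR_add_left scaleR_scaleR
          by (simp add: distrib_left scaleR_left_distrib)
        then have mu: "m = (1 - u) *\<^sub>R w + u *\<^sub>R v" unfolding c by simp
        have "w \<noteq> v"
        proof
          assume eq: "w = v"
          have "(1 - u) *\<^sub>R w + u *\<^sub>R v = (1 - u + u) *\<^sub>R v"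
            unfolding eq scaleR_add_left ..
          then show False using False mu eq by simp
        qed
        then have "m \<in> open_segment w v" unfolding in_segment using u mu
          by (intro conjI exI[of _ u])
        moreover have "w \<in> supermodular_cone" using w by simp
        ultimately show ?thesis using face_ofD[OF F(1) _ _ v F(2)] by simp
      qed (simp add: F)
    qed
  qed
qed

lemma generated_face_eq_iff_independence_structure:
  assumes "m \<in> supermodular_cone" "r \<in> supermodular_cone"
  shows "generated_face supermodular_cone m = generated_face supermodular_cone r \<longleftrightarrow>
    independence_structure m = independence_structure r"
proof
  assume "generated_face supermodular_cone m = generated_face supermodular_cone r"
  then have "m \<in> generated_face supermodular_cone r" "r \<in> generated_face supermodular_cone m"
    using generated_face_smallest(2)[OF convex_supermodular_cone] assms by (metis, metis)
  then show "independence_structure m = independence_structure r"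
    by (simp add: generated_face_supermodular_cone assms subset_antisym)
qed (simp add: generated_face_supermodular_cone assms)

subsection \<open>Enumerations and the vertices of the core\<close>

declare One_nat_def [simp del] \<comment> \<open>keeps the prefixes \<open>\<epsilon> ` {1..k}\<close> in this form\<close>

section \<open>Enumerations, positions and prefixes\<close>

lemma enumerations_inj_on:
  "\<epsilon> \<in> enumerations \<Longrightarrow> inj_on (\<epsilon> :: nat \<Rightarrow> 'n::finite) {1..CARD('n)}"
  by (simp add: enumerations_def bij_betw_def)

lemma enumerations_image:
  "\<epsilon> \<in> enumerations \<Longrightarrow> (\<epsilon> :: nat \<Rightarrow> 'n::finite) ` {1..CARD('n)} = UNIV"
  by (simp add: enumerations_def bij_betw_def)

text \<open>Extensionality places the enumerations inside a finite product of copies of the finite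
  type.\<close>

lemma finite_enumerations: "finite (enumerations :: (nat \<Rightarrow> 'n::finite) set)"
  by (rule finite_subset[OF _ finite_PiE[of "{1..CARD('n)}" "\<lambda>_. UNIV"]])
    (auto simp: enumerations_def PiE_def)

lemma position_enumeration:
  assumes "\<epsilon> \<in> enumerations" "1 \<le> i" "i \<le> CARD('n)"
  shows "position (\<epsilon> :: nat \<Rightarrow> 'n::finite) (\<epsilon> i) = i"
  unfolding position_def using assms enumerations_inj_on by (intro inv_into_f_f) auto

text \<open>The position is written \<open>Suc k\<close>, so that the element is the one added in
  passing from the prefix of length \<open>k\<close> to the next.\<close>

lemma enumeration_cases:
  assumes "\<epsilon> \<in> enumerations"
  obtains k where "k < CARD('n)" "(u :: 'n::finite) = \<epsilon> (Suc k)"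
proof -
  have "u \<in> \<epsilon> ` {1..CARD('n)}" using enumerations_image[OF assms] by simp
  then obtain i where "1 \<le> i" "i \<le> CARD('n)" "u = \<epsilon> i" by auto
  then show ?thesis using that[of "i - 1"] by simp
qed

lemma image_prefix_Suc: "\<epsilon> ` {1..Suc k} = insert (\<epsilon> (Suc k)) (\<epsilon> ` {1..k})"
  by (simp add: atLeastAtMostSuc_conv)

lemma enumeration_eq_iff:
  fixes \<epsilon> :: "nat \<Rightarrow> 'n::finite"
  assumes "\<epsilon> \<in> enumerations" "1 \<le> i" "i \<le> CARD('n)" "1 \<le> j" "j \<le> CARD('n)"
  shows "\<epsilon> i = \<epsilon> j \<longleftrightarrow> i = j"
  using inj_on_eq_iff[OF enumerations_inj_on[OF assms(1)]] assms by simp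

lemma enumeration_mem_prefix_iff:
  fixes \<epsilon> :: "nat \<Rightarrow> 'n::finite"
  assumes "\<epsilon> \<in> enumerations" "1 \<le> i" "i \<le> CARD('n)" "k \<le> CARD('n)"
  shows "\<epsilon> i \<in> \<epsilon> ` {1..k} \<longleftrightarrow> i \<le> k"
proof
  assume "\<epsilon> i \<in> \<epsilon> ` {1..k}"
  then obtain j where "1 \<le> j" "j \<le> k" "\<epsilon> i = \<epsilon> j" by auto
  then show "i \<le> k" using enumeration_eq_iff[OF assms(1-3), of j] assms(4) by simp
qed (use assms in auto)

lemma prefix_eq_position:
  fixes \<epsilon> :: "nat \<Rightarrow> 'n::finite"
  assumes "\<epsilon> \<in> enumerations" "k \<le> CARD('n)"
  shows "\<epsilon> ` {1..k} = {u. position \<epsilon> u \<le> k}"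
proof (rule set_eqI)
  fix u
  obtain i where i: "i < CARD('n)" "u = \<epsilon> (Suc i)" using enumeration_cases[OF assms(1)] .
  then show "u \<in> \<epsilon> ` {1..k} \<longleftrightarrow> u \<in> {u. position \<epsilon> u \<le> k}"
    using enumeration_mem_prefix_iff[OF assms(1) _ _ assms(2), of "Suc i"]
      position_enumeration[OF assms(1), of "Suc i"] by simp
qed

lemma position_le_card:
  fixes \<epsilon> :: "nat \<Rightarrow> 'n::finite"
  assumes "\<epsilon> \<in> enumerations"
  shows "position \<epsilon> u \<le> CARD('n)"
proof -
  obtain i where i: "i < CARD('n)" "u = \<epsilon> (Suc i)" using enumeration_cases[OF assms] .
  then show ?thesis using position_enumeration[OF assms, of "Suc i"] by simp
qed

text \<open>Source of concrete enumerations. Lists are indexed from 0 and enumerations from 1, hence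
  the shift; prefixes correspond to \<open>take\<close>.\<close>

lemma enumeration_of_list:
  fixes xs :: "'n::finite list"
  assumes "distinct xs" "set xs = UNIV"
  obtains \<epsilon> where "\<epsilon> \<in> enumerations" "\<And>i. i < CARD('n) \<Longrightarrow> \<epsilon> (Suc i) = xs ! i"
    "\<And>k. k \<le> CARD('n) \<Longrightarrow> \<epsilon> ` {1..k} = set (take k xs)"
proof -
  have len: "length xs = CARD('n)" using assms distinct_card by fastforce
  define \<epsilon> where "\<epsilon> = restrict (\<lambda>i. xs ! (i - 1)) {1..CARD('n)}"
  have nth: "\<epsilon> (Suc i) = xs ! i" if "i < CARD('n)" for i using that by (simp add: \<epsilon>_def)
  have img: "\<epsilon> ` {1..k} = set (take k xs)" if "k \<le> CARD('n)" for k
  proof -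
    have "\<epsilon> ` {1..k} = (\<epsilon> \<circ> Suc) ` {..<k}" unfolding image_comp[symmetric] image_Suc_lessThan ..
    also have "\<dots> = (!) xs ` {..<k}" using nth that by (intro image_cong) auto
    also have "\<dots> = set (take k xs)" using that len by (simp add: nth_image lessThan_atLeast0)
    finally show ?thesis .
  qed
  have "\<epsilon> ` {1..CARD('n)} = UNIV" using img[of "CARD('n)"] len assms by simp
  moreover from this have "inj_on \<epsilon> {1..CARD('n)}" by (intro eq_card_imp_inj_on) simp_all
  ultimately have "\<epsilon> \<in> enumerations"
    by (simp add: enumerations_def bij_betw_def \<epsilon>_def)
  then show ?thesis using that nth img by blast
qed

lemma sorting_enumeration:
  fixes x :: "real ^ 'n::finite"
  obtains \<epsilon> where "\<epsilon> \<in> enumerations"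
    "\<And>i j. 1 \<le> i \<Longrightarrow> i \<le> j \<Longrightarrow> j \<le> CARD('n) \<Longrightarrow> x $ \<epsilon> i \<le> x $ \<epsilon> j"
proof -
  obtain l where l: "set l = (UNIV :: 'n set)" "distinct l"
    using finite_distinct_list[of "UNIV :: 'n set"] by auto
  define xs where "xs = sort_key (($) x) l"
  have xs: "distinct xs" "set xs = UNIV" "sorted (map (($) x) xs)"
    using l by (simp_all add: xs_def)
  then have len: "length xs = CARD('n)" using distinct_card by fastforce
  obtain \<epsilon> where \<epsilon>: "\<epsilon> \<in> enumerations" "\<And>i. i < CARD('n) \<Longrightarrow> \<epsilon> (Suc i) = xs ! i"
    using enumeration_of_list[OF xs(1,2)] by metis
  have "x $ \<epsilon> i \<le> x $ \<epsilon> j" if "1 \<le> i" "i \<le> j" "j \<le> CARD('n)" for i j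
  proof -
    have "\<epsilon> i = xs ! (i - 1)" "\<epsilon> j = xs ! (j - 1)" using \<epsilon>(2)[of "i - 1"] \<epsilon>(2)[of "j - 1"] that
      by auto
    then show ?thesis using sorted_nth_mono[OF xs(3), of "i - 1" "j - 1"] that len by auto
  qed
  then show ?thesis using that \<epsilon>(1) by blast
qed

section \<open>Prefix sums and summation by parts\<close>

lemma sum_prefix_Suc:
  fixes \<epsilon> :: "nat \<Rightarrow> 'n::finite"
  assumes "\<epsilon> \<in> enumerations" "k < CARD('n)"
  shows "sum f (\<epsilon> ` {1..Suc k}) = f (\<epsilon> (Suc k)) + sum f (\<epsilon> ` {1..k})"
proof -
  have "\<epsilon> (Suc k) \<notin> \<epsilon> ` {1..k}"
    using enumeration_mem_prefix_iff[OF assms(1), of "Suc k" k] assms(2) by simp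
  then show ?thesis by (simp add: image_prefix_Suc)
qed

text \<open>Each coordinate is the difference of two consecutive prefix sums.\<close>

lemma vec_eq_if_prefix_sums_eq:
  fixes \<epsilon> :: "nat \<Rightarrow> 'n::finite" and y z :: "real ^ 'n"
  assumes \<epsilon>: "\<epsilon> \<in> enumerations"
    and eq: "\<And>k. k \<le> CARD('n) \<Longrightarrow> (\<Sum>l\<in>\<epsilon> ` {1..k}. y $ l) = (\<Sum>l\<in>\<epsilon> ` {1..k}. z $ l)"
  shows "y = z"
  unfolding vec_eq_iff
proof
  fix u
  obtain k where k: "k < CARD('n)" "u = \<epsilon> (Suc k)" using enumeration_cases[OF \<epsilon>] .
  then show "y $ u = z $ u"
    using sum_prefix_Suc[OF \<epsilon> k(1), of "($) y"] sum_prefix_Suc[OF \<epsilon> k(1), of "($) z"]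
      eq[of k] eq[of "Suc k"] by simp
qed

text \<open>Abel summation.\<close>

lemma sum_by_parts:
  fixes f g :: "nat \<Rightarrow> real"
  shows "(\<Sum>i=1..n. f i * g i) =
    f n * (\<Sum>i=1..n. g i) + (\<Sum>i=1..<n. (f i - f (Suc i)) * (\<Sum>j=1..i. g j))"
proof (induction n)
  case (Suc n)
  then show ?case by (cases "n = 0") (simp_all add: algebra_simps)
qed simp

text \<open>Abel summation along \<open>\<epsilon>\<close>; the boundary term vanishes because the
  totals agree. If \<open>x\<close> increases along \<open>\<epsilon>\<close>, the first factors are
  nonnegative, and only prefix sums have to be compared.\<close>

lemma inner_diff_by_parts:
  fixes \<epsilon> :: "nat \<Rightarrow> 'n::finite" and x y z :: "real ^ 'n"
  assumes \<epsilon>: "\<epsilon> \<in> enumerations" and total: "(\<Sum>l\<in>UNIV. y $ l) = (\<Sum>l\<in>UNIV. z $ l)"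
  shows "x \<bullet> (y - z) = (\<Sum>i=1..<CARD('n). (x $ \<epsilon> (Suc i) - x $ \<epsilon> i) *
    ((\<Sum>l\<in>\<epsilon> ` {1..i}. z $ l) - (\<Sum>l\<in>\<epsilon> ` {1..i}. y $ l)))"
proof -
  define d where "d = y - z"
  have prefix: "(\<Sum>l\<in>\<epsilon> ` {1..k}. f l) = (\<Sum>i=1..k. f (\<epsilon> i))" if "k \<le> CARD('n)"
    for k and f :: "'n \<Rightarrow> real"
    by (rule sum.reindex_cong[OF inj_on_subset[OF enumerations_inj_on[OF \<epsilon>]]]) (use that in auto)
  have all: "(\<Sum>l\<in>UNIV. f l) = (\<Sum>i=1..CARD('n). f (\<epsilon> i))" for f :: "'n \<Rightarrow> real"
    using prefix[of "CARD('n)" f] enumerations_image[OF \<epsilon>] by simp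
  have "x \<bullet> d = (\<Sum>i=1..CARD('n). x $ \<epsilon> i * d $ \<epsilon> i)"
    by (simp add: inner_vec_def all)
  also have "\<dots> = x $ \<epsilon> CARD('n) * (\<Sum>i=1..CARD('n). d $ \<epsilon> i) +
      (\<Sum>i=1..<CARD('n). (x $ \<epsilon> i - x $ \<epsilon> (Suc i)) * (\<Sum>j=1..i. d $ \<epsilon> j))"
    by (rule sum_by_parts)
  also have "(\<Sum>i=1..CARD('n). d $ \<epsilon> i) = 0"
    using total unfolding all by (simp add: d_def sum_subtractf)
  also have "(\<Sum>i=1..<CARD('n). (x $ \<epsilon> i - x $ \<epsilon> (Suc i)) * (\<Sum>j=1..i. d $ \<epsilon> j)) =
      (\<Sum>i=1..<CARD('n). (x $ \<epsilon> (Suc i) - x $ \<epsilon> i) *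
        ((\<Sum>l\<in>\<epsilon> ` {1..i}. z $ l) - (\<Sum>l\<in>\<epsilon> ` {1..i}. y $ l)))"
    by (rule sum.cong) (auto simp: prefix d_def sum_subtractf algebra_simps)
  finally show ?thesis by (simp add: d_def)
qed

section \<open>Marginal vectors and their tight sets\<close>

lemma core_total: "y \<in> core w \<Longrightarrow> (\<Sum>l\<in>UNIV. y $ l) = w $ UNIV"
  by (simp add: core_def)

lemma core_ge: "y \<in> core w \<Longrightarrow> w $ S \<le> (\<Sum>l\<in>S. y $ l)"
  by (simp add: core_def)

lemma marginal_vector_nth:
  fixes \<epsilon> :: "nat \<Rightarrow> 'n::finite"
  assumes "\<epsilon> \<in> enumerations" "k < CARD('n)"
  shows "marginal_vector w \<epsilon> $ \<epsilon> (Suc k) = w $ (\<epsilon> ` {1..Suc k}) - w $ (\<epsilon> ` {1..k})"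
  using position_enumeration[OF assms(1), of "Suc k"] assms(2)
  by (simp add: marginal_vector_def atLeastLessThanSuc_atLeastAtMost)

text \<open>Induction on \<open>k\<close>. A new element of \<open>S\<close> contributes its
  marginal value with respect to the whole prefix; this exceeds its marginal value with respect to
  the part of the prefix in \<open>S\<close> by exactly the new defect. A new element outside
  \<open>S\<close> adds a defect of nested sets, which is zero.\<close>

lemma sum_marginal_vector_prefix:
  fixes \<epsilon> :: "nat \<Rightarrow> 'n::finite"
  assumes \<epsilon>: "\<epsilon> \<in> enumerations" and "w $ {} = 0" and "k \<le> CARD('n)"
  shows "(\<Sum>l\<in>S \<inter> \<epsilon> ` {1..k}. marginal_vector w \<epsilon> $ l) = w $ (S \<inter> \<epsilon> ` {1..k}) +
    (\<Sum>i<k. supermodular_defect w (S \<inter> \<epsilon> ` {1..Suc i}) (\<epsilon> ` {1..i}))"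
  using assms(3)
proof (induction k)
  case (Suc k)
  then have k: "k < CARD('n)" by simp
  let ?P = "\<epsilon> ` {1..k}" and ?v = "\<epsilon> (Suc k)"
  have v: "?v \<notin> ?P" using enumeration_mem_prefix_iff[OF \<epsilon>, of "Suc k" k] k by simp
  show ?case
  proof (cases "?v \<in> S")
    case True
    then have S: "S \<inter> \<epsilon> ` {1..Suc k} = insert ?v (S \<inter> ?P)" by (auto simp: image_prefix_Suc)
    have "insert ?v (S \<inter> ?P) \<union> ?P = insert ?v ?P" "insert ?v (S \<inter> ?P) \<inter> ?P = S \<inter> ?P"
      using v by auto
    then have "supermodular_defect w (S \<inter> \<epsilon> ` {1..Suc k}) ?P =
        w $ insert ?v ?P + w $ (S \<inter> ?P) - w $ insert ?v (S \<inter> ?P) - w $ ?P"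
      unfolding S supermodular_defect_def by simp
    moreover have "(\<Sum>l\<in>S \<inter> \<epsilon> ` {1..Suc k}. marginal_vector w \<epsilon> $ l) =
        marginal_vector w \<epsilon> $ ?v + (\<Sum>l\<in>S \<inter> ?P. marginal_vector w \<epsilon> $ l)"
      unfolding S using v by simp
    ultimately show ?thesis
      using Suc marginal_vector_nth[OF \<epsilon> k, of w] S by (simp add: image_prefix_Suc)
  next
    case False
    then have S: "S \<inter> \<epsilon> ` {1..Suc k} = S \<inter> ?P" by (auto simp: image_prefix_Suc)
    then have "supermodular_defect w (S \<inter> \<epsilon> ` {1..Suc k}) ?P = 0"
      by (simp add: supermodular_defect_subset)
    then show ?thesis using Suc by (simp add: S)
  qed
qed (simp add: assms)

text \<open>The case of the full prefix. It exhibits the excess of the marginal vector over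
  \<open>w\<close> at \<open>S\<close> as a sum of defects, which gives both membership in the core
  and the tight sets.\<close>

lemma sum_marginal_vector:
  fixes \<epsilon> :: "nat \<Rightarrow> 'n::finite"
  assumes "\<epsilon> \<in> enumerations" "w $ {} = 0"
  shows "(\<Sum>l\<in>S. marginal_vector w \<epsilon> $ l) = w $ S +
    (\<Sum>i<CARD('n). supermodular_defect w (S \<inter> \<epsilon> ` {1..Suc i}) (\<epsilon> ` {1..i}))"
  using sum_marginal_vector_prefix[OF assms, of "CARD('n)" S]
  by (simp add: enumerations_image[OF assms(1)])

text \<open>If \<open>S\<close> is itself the prefix of length \<open>k\<close>, all defects in the
  telescoped sum up to \<open>k\<close> belong to nested sets.\<close>

lemma prefix_tight_marginal_vector:
  fixes \<epsilon> :: "nat \<Rightarrow> 'n::finite"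
  assumes "\<epsilon> \<in> enumerations" "w $ {} = 0" "k \<le> CARD('n)"
  shows "\<epsilon> ` {1..k} \<in> tightness_class w (marginal_vector w \<epsilon>)"
proof -
  have "supermodular_defect w (\<epsilon> ` {1..k} \<inter> \<epsilon> ` {1..Suc i}) (\<epsilon> ` {1..i}) = 0" if "i < k" for i
  proof -
    have "\<epsilon> ` {1..i} \<subseteq> \<epsilon> ` {1..k} \<inter> \<epsilon> ` {1..Suc i}" using that by auto
    then show ?thesis by (metis supermodular_defect_commute supermodular_defect_subset)
  qed
  then show ?thesis
    using sum_marginal_vector_prefix[OF assms, of "\<epsilon> ` {1..k}"] by (simp add: tightness_class_def)
qed

text \<open>A sum of nonnegative defects is zero iff each of them is. The criterion only asks which
  defects vanish, not for the values of \<open>w\<close>.\<close>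

lemma mem_tightness_class_marginal_vector:
  fixes \<epsilon> :: "nat \<Rightarrow> 'n::finite"
  assumes "\<epsilon> \<in> enumerations" "w \<in> supermodular_cone"
  shows "S \<in> tightness_class w (marginal_vector w \<epsilon>) \<longleftrightarrow>
    (\<forall>i<CARD('n). supermodular_defect w (S \<inter> \<epsilon> ` {1..Suc i}) (\<epsilon> ` {1..i}) = 0)"
  using sum_marginal_vector[OF assms(1) supermodular_cone_empty[OF assms(2)], of S]
    supermodular_defect_nonneg[OF assms(2)]
  by (simp add: tightness_class_def sum_nonneg_eq_0_iff Ball_def)

lemma marginal_vector_in_core:
  assumes \<epsilon>: "\<epsilon> \<in> enumerations" and w: "w \<in> supermodular_cone"
  shows "marginal_vector w \<epsilon> \<in> core w"
proof -
  have "w $ S \<le> (\<Sum>l\<in>S. marginal_vector w \<epsilon> $ l)" for S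
    using sum_marginal_vector[OF \<epsilon> supermodular_cone_empty[OF w], of S]
      supermodular_defect_nonneg[OF w] by (simp add: sum_nonneg)
  moreover have "(\<Sum>l\<in>UNIV. marginal_vector w \<epsilon> $ l) = w $ UNIV"
    using prefix_tight_marginal_vector[OF \<epsilon> supermodular_cone_empty[OF w] order_refl]
    by (simp add: enumerations_image[OF \<epsilon>] tightness_class_def)
  ultimately show ?thesis by (simp add: core_def)
qed

text \<open>Tightness of the prefixes prescribes all prefix sums, and these determine the vector.
  Equality of marginal vectors thereby becomes a question about tight sets.\<close>

lemma eq_marginal_vector_iff:
  fixes \<epsilon> :: "nat \<Rightarrow> 'n::finite"
  assumes "\<epsilon> \<in> enumerations" "w \<in> supermodular_cone"
  shows "marginal_vector w \<epsilon> = y \<longleftrightarrow> (\<forall>k\<le>CARD('n). \<epsilon> ` {1..k} \<in> tightness_class w y)"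
proof
  assume "\<forall>k\<le>CARD('n). \<epsilon> ` {1..k} \<in> tightness_class w y"
  then show "marginal_vector w \<epsilon> = y"
    using prefix_tight_marginal_vector[OF assms(1) supermodular_cone_empty[OF assms(2)]]
    by (intro vec_eq_if_prefix_sums_eq[OF assms(1)]) (simp add: tightness_class_def)
qed (use prefix_tight_marginal_vector[OF assms(1) supermodular_cone_empty[OF assms(2)]] in auto)

section \<open>The core as a polytope and its vertices\<close>

lemma convex_core: "convex (core w)"
proof (rule convexI)
  fix x y and u v :: real
  assume x: "x \<in> core w" and y: "y \<in> core w" and uv: "0 \<le> u" "0 \<le> v" "u + v = 1"
  have sum: "(\<Sum>l\<in>S. (u *\<^sub>R x + v *\<^sub>R y) $ l) = u * (\<Sum>l\<in>S. x $ l) + v * (\<Sum>l\<in>S. y $ l)" for S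
    by (simp add: sum.distrib sum_distrib_left)
  have "w $ S \<le> u * (\<Sum>l\<in>S. x $ l) + v * (\<Sum>l\<in>S. y $ l)" for S
  proof -
    have "u * w $ S + v * w $ S \<le> u * (\<Sum>l\<in>S. x $ l) + v * (\<Sum>l\<in>S. y $ l)"
      using uv core_ge[OF x] core_ge[OF y] by (intro add_mono mult_left_mono) auto
    then show ?thesis using uv by (simp flip: distrib_right)
  qed
  then show "u *\<^sub>R x + v *\<^sub>R y \<in> core w"
    unfolding core_def mem_Collect_eq sum using core_total[OF x] core_total[OF y] uv
    by (simp flip: distrib_right)
qed

text \<open>
  By summation by parts, the marginal vector of an enumeration along which a linear functional
  increases maximizes this functional on the core; so no point of the core can be separated from
  the marginal vectors.
\<close>

lemma core_eq_convex_hull: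
  assumes w: "w \<in> supermodular_cone"
  shows "core w = convex hull (marginal_vector w ` enumerations)" (is "_ = ?H")
proof
  show "?H \<subseteq> core w"
    using marginal_vector_in_core[OF _ w] convex_core by (intro hull_minimal) auto
  show "core w \<subseteq> ?H"
  proof
    fix z assume z: "z \<in> core w"
    show "z \<in> ?H"
    proof (rule ccontr)
      assume "z \<notin> ?H"
      moreover have "closed ?H"
        by (intro compact_imp_closed finite_imp_compact_convex_hull finite_imageI finite_enumerations)
      ultimately obtain a b where ab: "a \<bullet> z < b" "\<And>v. v \<in> ?H \<Longrightarrow> b < a \<bullet> v"
        using separating_hyperplane_closed_point[of ?H z] by auto
      \<comment> \<open>The functional \<open>a\<close> is smaller at \<open>z\<close> than on the
        hull, so it is \<open>- a\<close> that has to increase along the enumeration; the marginal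
        vector then has \<open>a\<close>-value at most that of \<open>z\<close>.\<close>
      obtain \<epsilon> where \<epsilon>: "\<epsilon> \<in> enumerations"
        "\<And>i j. 1 \<le> i \<Longrightarrow> i \<le> j \<Longrightarrow> j \<le> CARD('a) \<Longrightarrow> (- a) $ \<epsilon> i \<le> (- a) $ \<epsilon> j"
        using sorting_enumeration[of "- a"] by blast
      have "0 \<le> (- a) \<bullet> (marginal_vector w \<epsilon> - z)"
        unfolding inner_diff_by_parts[OF \<epsilon>(1) core_total[OF marginal_vector_in_core[OF \<epsilon>(1) w],
            folded core_total[OF z]]]
      proof (intro sum_nonneg mult_nonneg_nonneg)
        fix i assume i: "i \<in> {1..<CARD('a)}"
        then show "0 \<le> (- a) $ \<epsilon> (Suc i) - (- a) $ \<epsilon> i" using \<epsilon>(2)[of i "Suc i"] by simp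
        show "0 \<le> (\<Sum>l\<in>\<epsilon> ` {1..i}. z $ l) - (\<Sum>l\<in>\<epsilon> ` {1..i}. marginal_vector w \<epsilon> $ l)"
          using prefix_tight_marginal_vector[OF \<epsilon>(1) supermodular_cone_empty[OF w], of i] i
            core_ge[OF z, of "\<epsilon> ` {1..i}"] by (simp add: tightness_class_def)
      qed
      moreover have "marginal_vector w \<epsilon> \<in> ?H" using \<epsilon>(1) by (intro hull_inc) simp
      ultimately show False using ab by (fastforce simp: inner_diff_right)
    qed
  qed
qed

text \<open>Both end points have sum at least \<open>w $ S\<close> over \<open>S\<close>; a mean
  with positive weights attains this bound only if both do.\<close>

lemma tight_open_segment:
  assumes xz: "x \<in> core w" "z \<in> core w" and y: "y \<in> open_segment x z"
    and S: "S \<in> tightness_class w y"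
  shows "S \<in> tightness_class w x"
proof -
  obtain u where u: "0 < u" "u < 1" "y = (1 - u) *\<^sub>R x + u *\<^sub>R z" using y by (auto simp: in_segment)
  have "w $ S = (1 - u) * (\<Sum>l\<in>S. x $ l) + u * (\<Sum>l\<in>S. z $ l)"
    using S by (simp add: tightness_class_def u sum.distrib sum_distrib_left)
  moreover have "u * w $ S \<le> u * (\<Sum>l\<in>S. z $ l)" using u core_ge[OF xz(2)] by simp
  ultimately have "(1 - u) * (\<Sum>l\<in>S. x $ l) \<le> (1 - u) * w $ S" by (simp add: algebra_simps)
  then have "(\<Sum>l\<in>S. x $ l) \<le> w $ S" using u by simp
  then show ?thesis using core_ge[OF xz(1), of S] by (simp add: tightness_class_def)
qed

text \<open>Extreme points of a convex hull lie in the generating set. Conversely, if a marginal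
  vector lay in an open segment of the core, its prefixes would be tight at both ends, so both ends
  would equal it.\<close>

lemma vertices_core:
  assumes w: "w \<in> supermodular_cone"
  shows "vertices (core w) = marginal_vector w ` enumerations"
proof
  show "vertices (core w) \<subseteq> marginal_vector w ` enumerations"
    using extreme_point_of_convex_hull
    unfolding core_eq_convex_hull[OF w] vertices_def by blast
  show "marginal_vector w ` enumerations \<subseteq> vertices (core w)"
  proof clarify
    fix \<epsilon> :: "nat \<Rightarrow> 'a" assume \<epsilon>: "\<epsilon> \<in> enumerations"
    have "marginal_vector w \<epsilon> \<notin> open_segment x z" if xz: "x \<in> core w" "z \<in> core w" for x z
    proof
      assume seg: "marginal_vector w \<epsilon> \<in> open_segment x z"
      then have "marginal_vector w \<epsilon> \<in> open_segment z x" by (simp add: open_segment_commute)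
      then have "marginal_vector w \<epsilon> = x" "marginal_vector w \<epsilon> = z"
        using tight_open_segment[OF xz seg] tight_open_segment[OF xz(2,1)]
          prefix_tight_marginal_vector[OF \<epsilon> supermodular_cone_empty[OF w]]
        unfolding eq_marginal_vector_iff[OF \<epsilon> w] by blast+
      then show False using seg by (simp add: open_segment_def)
    qed
    then show "marginal_vector w \<epsilon> \<in> vertices (core w)"
      using marginal_vector_in_core[OF \<epsilon> w] by (simp add: vertices_def extreme_point_of_def)
  qed
qed

subsection \<open>Combinatorial structures\<close>

text \<open>The independence structure determines which defects vanish, and these decide
  tightness.\<close>

lemma tightness_class_marginal_vector_eq:
  assumes "m \<in> supermodular_cone" "r \<in> supermodular_cone"
    and "independence_structure m = independence_structure r" and "\<epsilon> \<in> enumerations"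
  shows "tightness_class m (marginal_vector m \<epsilon>) = tightness_class r (marginal_vector r \<epsilon>)"
proof -
  have "supermodular_defect m D E = 0 \<longleftrightarrow> supermodular_defect r D E = 0" for D E
    using assms supermodular_defect_zero_mono by blast
  then show ?thesis
    using mem_tightness_class_marginal_vector[OF assms(4,1)]
      mem_tightness_class_marginal_vector[OF assms(4,2)] by blast
qed

text \<open>An edge of the full permutohedral graph, with its position: the part of
  \<open>permutohedral_adjacent\<close> that does not involve the game.\<close>

definition adjacent_swap :: "nat \<Rightarrow> (nat \<Rightarrow> 'n::finite) \<Rightarrow> (nat \<Rightarrow> 'n) \<Rightarrow> bool" where
  "adjacent_swap i \<epsilon> \<eta> \<longleftrightarrow> 1 \<le> i \<and> i < CARD('n) \<and> \<epsilon> i = \<eta> (Suc i) \<and> \<epsilon> (Suc i) = \<eta> i \<and>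
     (\<forall>k\<in>{1..CARD('n)} - {i, Suc i}. \<epsilon> k = \<eta> k)"

text \<open>A prefix of length other than \<open>i\<close> contains both swapped positions or
  neither.\<close>

lemma adjacent_swap_prefix:
  fixes \<epsilon> \<eta> :: "nat \<Rightarrow> 'n::finite"
  assumes sw: "adjacent_swap i \<epsilon> \<eta>" and k: "k \<le> CARD('n)" "k \<noteq> i"
  shows "\<eta> ` {1..k} = \<epsilon> ` {1..k}"
proof (cases "k < i")
  case True
  then show ?thesis using sw k by (intro image_cong) (auto simp: adjacent_swap_def)
next
  case False
  then have split: "{1..k} = ({1..k} - {i, Suc i}) \<union> {i, Suc i}" using sw k
    by (auto simp: adjacent_swap_def)
  have "\<eta> ` ({1..k} - {i, Suc i}) = \<epsilon> ` ({1..k} - {i, Suc i})"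
    using sw k by (intro image_cong) (auto simp: adjacent_swap_def)
  moreover have "\<eta> ` {i, Suc i} = \<epsilon> ` {i, Suc i}" using sw by (auto simp: adjacent_swap_def)
  ultimately show ?thesis by (subst (1 2) split) (simp only: image_Un)
qed

text \<open>The two enumerations share all prefixes except the one of length \<open>i\<close>, so
  only its tightness is at stake; its excess at the marginal vector of \<open>\<epsilon>\<close> is
  the elementary difference.\<close>

lemma marginal_vector_eq_iff_difference:
  fixes \<epsilon> \<eta> :: "nat \<Rightarrow> 'n::finite"
  assumes \<epsilon>: "\<epsilon> \<in> enumerations" and \<eta>: "\<eta> \<in> enumerations" and w: "w \<in> supermodular_cone"
    and sw: "adjacent_swap i \<epsilon> \<eta>"
  shows "marginal_vector w \<eta> = marginal_vector w \<epsilon> \<longleftrightarrow>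
    supermodular_difference w (\<epsilon> i) (\<epsilon> (Suc i)) (\<epsilon> ` {1..<i}) = 0"
proof -
  obtain k where i: "i = Suc k" using sw by (cases i) (auto simp: adjacent_swap_def)
  have k: "Suc k < CARD('n)" using sw i by (simp add: adjacent_swap_def)
  let ?P = "\<epsilon> ` {1..k}" and ?a = "\<epsilon> (Suc k)" and ?b = "\<epsilon> (Suc (Suc k))"
  note e = supermodular_cone_empty[OF w]
  have b: "?b \<notin> ?P" using enumeration_mem_prefix_iff[OF \<epsilon>, of "Suc (Suc k)" k] k by simp
  have \<eta>i: "\<eta> ` {1..i} = insert ?b ?P"
    using adjacent_swap_prefix[OF sw, of k] sw k by (simp add: i image_prefix_Suc adjacent_swap_def)
  have "marginal_vector w \<eta> = marginal_vector w \<epsilon> \<longleftrightarrow>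
      (\<forall>j\<le>CARD('n). \<eta> ` {1..j} \<in> tightness_class w (marginal_vector w \<epsilon>))"
    by (rule eq_marginal_vector_iff[OF \<eta> w])
  also have "\<dots> \<longleftrightarrow> \<eta> ` {1..i} \<in> tightness_class w (marginal_vector w \<epsilon>)"
    using adjacent_swap_prefix[OF sw] prefix_tight_marginal_vector[OF \<epsilon> e] k i
    by (metis less_imp_le)
  also have "\<dots> \<longleftrightarrow> marginal_vector w \<epsilon> $ ?b + (\<Sum>l\<in>?P. marginal_vector w \<epsilon> $ l) = w $ insert ?b ?P"
    unfolding \<eta>i tightness_class_def using b by simp
  also have "(\<Sum>l\<in>?P. marginal_vector w \<epsilon> $ l) = w $ ?P"
    using prefix_tight_marginal_vector[OF \<epsilon> e, of k] k by (simp add: tightness_class_def)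
  also have "marginal_vector w \<epsilon> $ ?b = w $ (insert ?b (insert ?a ?P)) - w $ insert ?a ?P"
    using marginal_vector_nth[OF \<epsilon> k, of w] by (simp add: image_prefix_Suc)
  also have "\<dots> + w $ ?P = w $ insert ?b ?P \<longleftrightarrow>
      supermodular_difference w (\<epsilon> i) (\<epsilon> (Suc i)) (\<epsilon> ` {1..<i}) = 0"
    by (auto simp: supermodular_difference_def i atLeastLessThanSuc_atLeastAtMost insert_commute)
  finally show ?thesis .
qed

lemma permutohedral_adjacent_iff:
  assumes "\<epsilon> \<in> enumerations" "\<eta> \<in> enumerations" "w \<in> supermodular_cone"
  shows "permutohedral_adjacent w \<epsilon> \<eta> \<longleftrightarrow>
    (\<exists>i. adjacent_swap i \<epsilon> \<eta>) \<and> marginal_vector w \<eta> = marginal_vector w \<epsilon>"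
  using marginal_vector_eq_iff_difference[OF assms]
  unfolding permutohedral_adjacent_def adjacent_swap_def Suc_eq_plus1 by blast

text \<open>List \<open>C\<close> first, then \<open>a\<close> and \<open>b\<close> in either order,
  then the remaining elements.\<close>

lemma swap_enumerations_of_triplet:
  fixes a b :: "'n::finite"
  assumes "a \<noteq> b" "a \<notin> C" "b \<notin> C"
  obtains \<epsilon> \<eta> i where "\<epsilon> \<in> enumerations" "\<eta> \<in> enumerations" "adjacent_swap i \<epsilon> \<eta>"
    "\<epsilon> i = a" "\<epsilon> (Suc i) = b" "\<epsilon> ` {1..<i} = C"
proof -
  obtain cs ds
    where l: "set cs = C" "distinct cs" "set ds = UNIV - insert a (insert b C)" "distinct ds"
    using finite_distinct_list[of C] finite_distinct_list[of "UNIV - insert a (insert b C)"] by auto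
  define xs ys where "xs = cs @ a # b # ds" and "ys = cs @ b # a # ds"
  have xs: "distinct xs" "set xs = UNIV" and ys: "distinct ys" "set ys = UNIV"
    using l assms by (auto simp: xs_def ys_def)
  have len: "length xs = CARD('n)" using xs distinct_card by fastforce
  obtain \<epsilon> where \<epsilon>: "\<epsilon> \<in> enumerations" "\<And>i. i < CARD('n) \<Longrightarrow> \<epsilon> (Suc i) = xs ! i"
    "\<And>k. k \<le> CARD('n) \<Longrightarrow> \<epsilon> ` {1..k} = set (take k xs)"
    using enumeration_of_list[OF xs] by metis
  obtain \<eta> where \<eta>: "\<eta> \<in> enumerations" "\<And>i. i < CARD('n) \<Longrightarrow> \<eta> (Suc i) = ys ! i"
    using enumeration_of_list[OF ys] by metis
  define k where "k = length cs"
  have k: "Suc k < CARD('n)" using len by (simp add: k_def xs_def)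
  have nth: "xs ! k = a" "xs ! Suc k = b" "ys ! k = b" "ys ! Suc k = a"
    by (simp_all add: xs_def ys_def k_def nth_append)
  have same: "xs ! j = ys ! j" if "j \<noteq> k" "j \<noteq> Suc k" for j
  proof (cases "j < k")
    case False
    then have "k + 2 \<le> j" using that by simp
    then obtain d where "j = k + 2 + d" by (rule le_Suc_ex[THEN exE])
    then show ?thesis by (simp add: xs_def ys_def k_def nth_append)
  qed (simp add: xs_def ys_def k_def nth_append)
  have "\<epsilon> j = \<eta> j" if "j \<in> {1..CARD('n)} - {Suc k, Suc (Suc k)}" for j
    using \<epsilon>(2)[of "j - 1"] \<eta>(2)[of "j - 1"] same[of "j - 1"] that by (cases j) auto
  then have "adjacent_swap (Suc k) \<epsilon> \<eta>"
    using k nth \<epsilon>(2)[of k] \<epsilon>(2)[of "Suc k"] \<eta>(2)[of k] \<eta>(2)[of "Suc k"]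
    by (simp add: adjacent_swap_def)
  moreover have "\<epsilon> ` {1..<Suc k} = C"
    using \<epsilon>(3)[of k] k l by (simp add: atLeastLessThanSuc_atLeastAtMost xs_def k_def)
  ultimately show ?thesis
    using that[of \<epsilon> \<eta> "Suc k"] \<epsilon> \<eta> nth k by simp
qed

text \<open>Every elementary triplet occurs at some adjacent swap, where its difference vanishes iff
  the marginal vectors agree. This is the way back from the other objects to the independence
  structure.\<close>

lemma independence_structure_eq_if_swaps:
  fixes m r :: "real ^ ('n::finite set)"
  assumes m: "m \<in> supermodular_cone" and r: "r \<in> supermodular_cone"
    and sw: "\<And>\<epsilon> \<eta> i. \<epsilon> \<in> enumerations \<Longrightarrow> \<eta> \<in> enumerations \<Longrightarrow> adjacent_swap i \<epsilon> \<eta> \<Longrightarrow>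
      marginal_vector m \<eta> = marginal_vector m \<epsilon> \<longleftrightarrow> marginal_vector r \<eta> = marginal_vector r \<epsilon>"
  shows "independence_structure m = independence_structure r"
proof -
  have "(a, b, C) \<in> independence_structure m \<longleftrightarrow> (a, b, C) \<in> independence_structure r"
    for a b :: 'n and C
  proof (cases "a \<noteq> b \<and> a \<notin> C \<and> b \<notin> C")
    case True
    then obtain \<epsilon> \<eta> i where \<epsilon>\<eta>: "\<epsilon> \<in> enumerations" "\<eta> \<in> enumerations" "adjacent_swap i \<epsilon> \<eta>"
      "\<epsilon> i = a" "\<epsilon> (Suc i) = b" "\<epsilon> ` {1..<i} = C"
      using swap_enumerations_of_triplet by metis
    have "supermodular_difference m a b C = 0 \<longleftrightarrow> supermodular_difference r a b C = 0"
      using marginal_vector_eq_iff_difference[OF \<epsilon>\<eta>(1,2) m \<epsilon>\<eta>(3)]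
        marginal_vector_eq_iff_difference[OF \<epsilon>\<eta>(1,2) r \<epsilon>\<eta>(3)] sw[OF \<epsilon>\<eta>(1-3)] \<epsilon>\<eta>(4-6) by simp
    then show ?thesis by (simp add: independence_structure_def)
  qed (auto simp: mem_independence_structure)
  then show ?thesis by auto
qed

text \<open>The prefixes of \<open>\<epsilon>\<close> are tight for \<open>r\<close> at
  \<open>y\<close>, which forces \<open>y\<close> to be the marginal vector of \<open>r\<close>.
  Since \<open>y\<close> may be any vector, the lemma serves both the tightness structure and the
  normal fan.\<close>

lemma independence_structure_eq_if_tight:
  assumes m: "m \<in> supermodular_cone" and r: "r \<in> supermodular_cone"
    and tight: "\<And>\<epsilon>. \<epsilon> \<in> enumerations \<Longrightarrow>
      \<exists>y. tightness_class m (marginal_vector m \<epsilon>) = tightness_class r y"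
  shows "independence_structure m = independence_structure r"
proof (rule independence_structure_eq_if_swaps[OF m r])
  fix \<epsilon> \<eta> :: "nat \<Rightarrow> 'a" assume \<epsilon>: "\<epsilon> \<in> enumerations" and \<eta>: "\<eta> \<in> enumerations"
  obtain y where y: "tightness_class m (marginal_vector m \<epsilon>) = tightness_class r y"
    using tight[OF \<epsilon>] by blast
  then have "marginal_vector r \<epsilon> = y"
    using prefix_tight_marginal_vector[OF \<epsilon> supermodular_cone_empty[OF m]]
    by (simp add: eq_marginal_vector_iff[OF \<epsilon> r])
  then show "marginal_vector m \<eta> = marginal_vector m \<epsilon> \<longleftrightarrow> marginal_vector r \<eta> = marginal_vector r \<epsilon>"
    using y by (simp add: eq_marginal_vector_iff[OF \<eta> m] eq_marginal_vector_iff[OF \<eta> r])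
qed

lemma marginal_vector_eq_transfer:
  assumes "m \<in> supermodular_cone" "r \<in> supermodular_cone"
    and "independence_structure m = independence_structure r"
    and "\<epsilon> \<in> enumerations" "\<eta> \<in> enumerations"
  shows "marginal_vector m \<eta> = marginal_vector m \<epsilon> \<longleftrightarrow> marginal_vector r \<eta> = marginal_vector r \<epsilon>"
  using tightness_class_marginal_vector_eq[OF assms(1-4)]
  by (simp add: eq_marginal_vector_iff[OF assms(5,1)] eq_marginal_vector_iff[OF assms(5,2)])

section \<open>Permutohedral subgraph and enumeration partition\<close>

lemma permutohedral_subgraph_eq_iff:
  assumes m: "m \<in> supermodular_cone" and r: "r \<in> supermodular_cone"
  shows "permutohedral_subgraph m = permutohedral_subgraph r \<longleftrightarrow>
    independence_structure m = independence_structure r"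
proof
  assume eq: "independence_structure m = independence_structure r"
  have "permutohedral_adjacent m \<epsilon> \<eta> = permutohedral_adjacent r \<epsilon> \<eta>"
    if "\<epsilon> \<in> enumerations" "\<eta> \<in> enumerations" for \<epsilon> \<eta>
    using that marginal_vector_eq_transfer[OF m r eq] by (simp add: permutohedral_adjacent_iff m r)
  then show "permutohedral_subgraph m = permutohedral_subgraph r"
    unfolding permutohedral_subgraph_def
      by (intro arg_cong2[of _ _ _ _ Pair] refl Collect_cong) blast
next
  define edges :: "real ^ 'a set \<Rightarrow> (nat \<Rightarrow> 'a) set set" where
    "edges w = snd (permutohedral_subgraph w)" for w
  assume eq: "permutohedral_subgraph m = permutohedral_subgraph r"
  have edge: "{\<epsilon>, \<eta>} \<in> edges w \<longleftrightarrow> marginal_vector w \<eta> = marginal_vector w \<epsilon>"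
    if \<epsilon>\<eta>: "\<epsilon> \<in> enumerations" "\<eta> \<in> enumerations" "adjacent_swap i \<epsilon> \<eta>"
      and w: "w \<in> supermodular_cone" for \<epsilon> \<eta> :: "nat \<Rightarrow> 'a" and i w
  proof
    assume "{\<epsilon>, \<eta>} \<in> edges w"
    then obtain \<epsilon>' \<eta>' where "{\<epsilon>, \<eta>} = {\<epsilon>', \<eta>'}" "\<epsilon>' \<in> enumerations" "\<eta>' \<in> enumerations"
      "permutohedral_adjacent w \<epsilon>' \<eta>'" by (auto simp: edges_def permutohedral_subgraph_def)
    \<comment> \<open>The edge is unordered, so its witnesses may come in reverse order; equality of
      marginal vectors is symmetric.\<close>
    then show "marginal_vector w \<eta> = marginal_vector w \<epsilon>"
      using permutohedral_adjacent_iff[OF _ _ w] by (metis doubleton_eq_iff)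
  next
    assume "marginal_vector w \<eta> = marginal_vector w \<epsilon>"
    then have "permutohedral_adjacent w \<epsilon> \<eta>" using permutohedral_adjacent_iff[OF \<epsilon>\<eta>(1,2) w] \<epsilon>\<eta>(3)
      by blast
    then show "{\<epsilon>, \<eta>} \<in> edges w" using \<epsilon>\<eta> by (auto simp: edges_def permutohedral_subgraph_def)
  qed
  show "independence_structure m = independence_structure r"
    using edge[OF _ _ _ m] edge[OF _ _ _ r] eq
    by (intro independence_structure_eq_if_swaps[OF m r]) (simp add: edges_def)
qed

lemma enumeration_partition_eq_image:
  assumes "w \<in> supermodular_cone"
  shows "enumeration_partition w = (\<lambda>\<epsilon>. marginal_fibre w (marginal_vector w \<epsilon>)) ` enumerations"
  unfolding enumeration_partition_def vertices_core[OF assms] by blast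

lemma marginal_fibre_cong:
  assumes "m \<in> supermodular_cone" "r \<in> supermodular_cone"
    and "independence_structure m = independence_structure r" and "\<epsilon> \<in> enumerations"
  shows "marginal_fibre m (marginal_vector m \<epsilon>) = marginal_fibre r (marginal_vector r \<epsilon>)"
  using marginal_vector_eq_transfer[OF assms] by (auto simp: marginal_fibre_def)

lemma enumeration_partition_eq_iff:
  assumes m: "m \<in> supermodular_cone" and r: "r \<in> supermodular_cone"
  shows "enumeration_partition m = enumeration_partition r \<longleftrightarrow>
    independence_structure m = independence_structure r"
proof
  assume "independence_structure m = independence_structure r"
  then show "enumeration_partition m = enumeration_partition r"
    unfolding enumeration_partition_eq_image[OF m] enumeration_partition_eq_image[OF r]
    using marginal_fibre_cong[OF m r] by (intro image_cong) auto
next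
  \<comment> \<open>Lying in a common block is a condition on the partition alone.\<close>
  have same_fibre: "marginal_vector w \<eta> = marginal_vector w \<epsilon> \<longleftrightarrow>
      (\<exists>B\<in>enumeration_partition w. \<epsilon> \<in> B \<and> \<eta> \<in> B)"
    if "\<epsilon> \<in> enumerations" "\<eta> \<in> enumerations" "w \<in> supermodular_cone"
    for \<epsilon> \<eta> :: "nat \<Rightarrow> 'a" and w
    using that by (auto simp: enumeration_partition_eq_image marginal_fibre_def)
  assume "enumeration_partition m = enumeration_partition r"
  then show "independence_structure m = independence_structure r"
    using same_fibre[OF _ _ m] same_fibre[OF _ _ r]
    by (intro independence_structure_eq_if_swaps[OF m r]) simp
qed

section \<open>Tight sets as a lattice and the fan of posets\<close>

lemma tightness_class_lattice:
  assumes y: "y \<in> core w" and w: "w \<in> supermodular_cone"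
    and S: "S \<in> tightness_class w y" and T: "T \<in> tightness_class w y"
  shows "S \<union> T \<in> tightness_class w y" "S \<inter> T \<in> tightness_class w y"
proof -
  \<comment> \<open>The excesses at the union and the intersection are nonnegative in the core, and
    by supermodularity their sum is at most zero.\<close>
  have "(\<Sum>l\<in>S \<union> T. y $ l) + (\<Sum>l\<in>S \<inter> T. y $ l) = (\<Sum>l\<in>S. y $ l) + (\<Sum>l\<in>T. y $ l)"
    by (rule sum.union_inter) simp_all
  also have "\<dots> \<le> w $ (S \<union> T) + w $ (S \<inter> T)"
    using S T w by (simp add: tightness_class_def supermodular_cone_def)
  finally show "S \<union> T \<in> tightness_class w y" "S \<inter> T \<in> tightness_class w y"
    using core_ge[OF y, of "S \<union> T"] core_ge[OF y, of "S \<inter> T"] by (simp_all add: tightness_class_def)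
qed

text \<open>
  A fibre consists of all linear extensions of its poset: a down-set \<open>D\<close> of the poset is the union
  over \<open>v \<in> D\<close> of the intersections over \<open>u \<notin> D\<close> of prefixes that contain \<open>v\<close> but not \<open>u\<close>, and the
  tight sets form a lattice.
\<close>

lemma down_set_tight:
  fixes w :: "real ^ ('n::finite set)"
  assumes y: "y \<in> core w" and w: "w \<in> supermodular_cone"
    and D: "\<And>u v. (u, v) \<in> common_order (marginal_fibre w y) \<Longrightarrow> v \<in> D \<Longrightarrow> u \<in> D"
  shows "D \<in> tightness_class w y"
proof -
  have "{} \<in> tightness_class w y" "UNIV \<in> tightness_class w y"
    using core_total[OF y] supermodular_cone_empty[OF w] by (simp_all add: tightness_class_def)
  \<comment> \<open>The sets \<open>{}\<close> and \<open>UNIV\<close> are the empty union and the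
    empty intersection, which occur when \<open>D\<close> is empty or everything.\<close>
  note closed = this tightness_class_lattice[OF y w]
  have Un: "\<Union>\<A> \<in> tightness_class w y" if "finite \<A>" "\<A> \<subseteq> tightness_class w y" for \<A>
    using that by (induction) (auto intro: closed)
  have Int: "\<Inter>\<A> \<in> tightness_class w y" if "finite \<A>" "\<A> \<subseteq> tightness_class w y" for \<A>
    using that by (induction) (auto intro: closed)
  have "\<exists>A\<in>tightness_class w y. v \<in> A \<and> u \<notin> A" if "v \<in> D" "u \<notin> D" for u v
  proof -
    have "(u, v) \<notin> common_order (marginal_fibre w y)" using D that by blast
    then obtain \<epsilon>
      where \<epsilon>: "\<epsilon> \<in> enumerations" "marginal_vector w \<epsilon> = y" "position \<epsilon> v < position \<epsilon> u"
      by (auto simp: common_order_def marginal_fibre_def not_le)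
    let ?A = "\<epsilon> ` {1..position \<epsilon> v}"
    have "?A \<in> tightness_class w y"
      using \<epsilon>(1,2) position_le_card[OF \<epsilon>(1)] eq_marginal_vector_iff[OF \<epsilon>(1) w] by blast
    moreover have "v \<in> ?A" "u \<notin> ?A" using \<epsilon>(3)
      by (simp_all add: prefix_eq_position[OF \<epsilon>(1) position_le_card[OF \<epsilon>(1)]])
    ultimately show ?thesis by blast
  qed
  then obtain A where A: "\<And>u v. v \<in> D \<Longrightarrow> u \<notin> D \<Longrightarrow> A v u \<in> tightness_class w y \<and> v \<in> A v u \<and> u \<notin> A v u"
    by metis
  have "D = (\<Union>v\<in>D. \<Inter>u\<in>- D. A v u)" using A by blast
  moreover have "(\<Union>v\<in>D. \<Inter>u\<in>- D. A v u) \<in> tightness_class w y"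
    using A by (auto intro!: Un Int)
  ultimately show ?thesis by simp
qed

text \<open>The prefixes of an enumeration extending the poset are down-sets, hence tight, so the
  enumeration belongs to the fibre.\<close>

lemma marginal_fibre_eq_linear_extensions:
  assumes y: "y \<in> core w" and w: "w \<in> supermodular_cone"
  shows "marginal_fibre w y =
    {\<epsilon> \<in> enumerations. common_order (marginal_fibre w y) \<subseteq> {(u, v). position \<epsilon> u \<le> position \<epsilon> v}}"
    (is "_ = ?L")
proof
  show "marginal_fibre w y \<subseteq> ?L" by (auto simp: marginal_fibre_def common_order_def)
  show "?L \<subseteq> marginal_fibre w y"
  proof
    fix \<epsilon> assume "\<epsilon> \<in> ?L"
    then have \<epsilon>: "\<epsilon> \<in> enumerations"
      and ext: "\<And>u v. (u, v) \<in> common_order (marginal_fibre w y) \<Longrightarrow> position \<epsilon> u \<le> position \<epsilon> v"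
        by auto
    have "\<epsilon> ` {1..k} \<in> tightness_class w y" if "k \<le> CARD('a)" for k
      unfolding prefix_eq_position[OF \<epsilon> that]
      by (rule down_set_tight[OF y w]) (use ext in fastforce)
    then show "\<epsilon> \<in> marginal_fibre w y" using \<epsilon> eq_marginal_vector_iff[OF \<epsilon> w]
      by (simp add: marginal_fibre_def)
  qed
qed

text \<open>Recovers the partition from the fan by a map that does not depend on
  \<open>w\<close>.\<close>

lemma enumeration_partition_eq_linear_extensions:
  assumes w: "w \<in> supermodular_cone"
  shows "enumeration_partition w =
    (\<lambda>P. {\<epsilon> \<in> enumerations. P \<subseteq> {(u, v). position \<epsilon> u \<le> position \<epsilon> v}}) ` fan_of_posets w"
proof -
  have core: "y \<in> core w" if "y \<in> vertices (core w)" for y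
    using that by (simp add: vertices_def extreme_point_of_def)
  have "enumeration_partition w = marginal_fibre w ` vertices (core w)"
    by (auto simp: enumeration_partition_def)
  also have "\<dots> = (\<lambda>y. {\<epsilon> \<in> enumerations.
      common_order (marginal_fibre w y) \<subseteq> {(u, v). position \<epsilon> u \<le> position \<epsilon> v}}) ` vertices (core w)"
    by (intro image_cong refl marginal_fibre_eq_linear_extensions core w)
  finally show ?thesis by (auto simp: fan_of_posets_def)
qed

lemma fan_of_posets_eq_iff:
  assumes m: "m \<in> supermodular_cone" and r: "r \<in> supermodular_cone"
  shows "fan_of_posets m = fan_of_posets r \<longleftrightarrow> independence_structure m = independence_structure r"
proof -
  have image: "fan_of_posets w = common_order ` enumeration_partition w" for w :: "real ^ 'a set"
    by (auto simp: fan_of_posets_def enumeration_partition_def)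
  have "fan_of_posets m = fan_of_posets r \<longleftrightarrow> enumeration_partition m = enumeration_partition r"
  proof
    assume "fan_of_posets m = fan_of_posets r"
    then show "enumeration_partition m = enumeration_partition r"
      by (simp only: enumeration_partition_eq_linear_extensions m r)
  qed (simp only: image)
  then show ?thesis by (simp only: enumeration_partition_eq_iff[OF m r])
qed

section \<open>Tightness structure\<close>

lemma tightness_structure_eq_image:
  assumes "w \<in> supermodular_cone"
  shows "tightness_structure w = (\<lambda>\<epsilon>. tightness_class w (marginal_vector w \<epsilon>)) ` enumerations"
  unfolding tightness_structure_def vertices_core[OF assms] by blast

lemma tightness_structure_eq_iff:
  assumes m: "m \<in> supermodular_cone" and r: "r \<in> supermodular_cone"
  shows "tightness_structure m = tightness_structure r \<longleftrightarrow>
    independence_structure m = independence_structure r"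
proof
  assume "independence_structure m = independence_structure r"
  then show "tightness_structure m = tightness_structure r"
    unfolding tightness_structure_eq_image[OF m] tightness_structure_eq_image[OF r]
    using tightness_class_marginal_vector_eq[OF m r] by (intro image_cong) auto
next
  assume "tightness_structure m = tightness_structure r"
  then have "\<exists>y. tightness_class m (marginal_vector m \<epsilon>) = tightness_class r y"
    if "\<epsilon> \<in> enumerations" for \<epsilon>
    using that unfolding tightness_structure_eq_image[OF m] tightness_structure_eq_image[OF r]
      by blast
  then show "independence_structure m = independence_structure r"
    by (rule independence_structure_eq_if_tight[OF m r])
qed

subsection \<open>The normal fan of the core\<close>

text \<open>
  Both inclusions compare \<open>y\<close> with points of the core by summation by parts along an enumeration
  sorting \<open>x\<close>; the prefixes at which \<open>x\<close> jumps are the proper sublevel sets of \<open>x\<close>.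
\<close>

lemma mem_normal_cone_core_iff:
  fixes w :: "real ^ ('n::finite set)" and x y :: "real ^ 'n"
  assumes y: "y \<in> core w" and w: "w \<in> supermodular_cone"
  shows "x \<in> normal_cone (core w) y \<longleftrightarrow> (\<forall>t. {u. x $ u \<le> t} \<in> tightness_class w y)"
proof -
  obtain \<epsilon> where \<epsilon>: "\<epsilon> \<in> enumerations"
    and mono: "\<And>i j. 1 \<le> i \<Longrightarrow> i \<le> j \<Longrightarrow> j \<le> CARD('n) \<Longrightarrow> x $ \<epsilon> i \<le> x $ \<epsilon> j"
    using sorting_enumeration[of x] by blast
  define jump where "jump i = x $ \<epsilon> (Suc i) - x $ \<epsilon> i" for i
  have jump: "0 \<le> jump i" if "i \<in> {1..<CARD('n)}" for i
    using that mono[of i "Suc i"] by (simp add: jump_def)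
  have parts: "x \<bullet> (y - z) = (\<Sum>i=1..<CARD('n). jump i *
      ((\<Sum>l\<in>\<epsilon> ` {1..i}. z $ l) - (\<Sum>l\<in>\<epsilon> ` {1..i}. y $ l)))" if "z \<in> core w" for z
    unfolding jump_def using core_total[OF that] core_total[OF y]
      by (intro inner_diff_by_parts \<epsilon>) simp
  show ?thesis
  proof (intro iffI allI)
    fix t assume x: "x \<in> normal_cone (core w) y"
    \<comment> \<open>The last position whose value is at most \<open>t\<close>; the inserted 0
      stands for the case that there is none and yields the empty prefix.\<close>
    define k where "k = Max (insert 0 {i \<in> {1..CARD('n)}. x $ \<epsilon> i \<le> t})"
    have fin: "finite (insert 0 {i \<in> {1..CARD('n)}. x $ \<epsilon> i \<le> t})" by simp
    have kn: "k \<le> CARD('n)" unfolding k_def using fin by (subst Max_le_iff) auto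
    have "k \<in> insert 0 {i \<in> {1..CARD('n)}. x $ \<epsilon> i \<le> t}" unfolding k_def by (rule Max_in) auto
    then have kt: "x $ \<epsilon> k \<le> t" if "1 \<le> k" using that by auto
    have ge: "i \<le> k" if "1 \<le> i" "i \<le> CARD('n)" "x $ \<epsilon> i \<le> t" for i
      unfolding k_def using that by (intro Max_ge) auto
    have sub: "{u. x $ u \<le> t} = \<epsilon> ` {1..k}"
    proof (intro equalityI subsetI)
      fix u assume "u \<in> {u. x $ u \<le> t}"
      moreover obtain j where "j < CARD('n)" "u = \<epsilon> (Suc j)" using enumeration_cases[OF \<epsilon>] .
      ultimately show "u \<in> \<epsilon> ` {1..k}" using ge[of "Suc j"] by auto
    next
      fix u assume "u \<in> \<epsilon> ` {1..k}"
      then obtain i where "1 \<le> i" "i \<le> k" "u = \<epsilon> i" by auto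
      then show "u \<in> {u. x $ u \<le> t}" using mono[of i k] kn kt by auto
    qed
    consider "k = 0" | "k = CARD('n)" | "k \<in> {1..<CARD('n)}" using kn by fastforce
    then show "{u. x $ u \<le> t} \<in> tightness_class w y"
    proof cases
      case 1
      then show ?thesis using supermodular_cone_empty[OF w] by (simp add: sub tightness_class_def)
    next
      case 2
      then show ?thesis
        using core_total[OF y] enumerations_image[OF \<epsilon>] by (simp add: sub tightness_class_def)
    next
      case 3
      \<comment> \<open>Comparison with this point of the core gives a sum of nonnegative terms that
        is at most zero, so the term at \<open>k\<close> vanishes; its jump is positive since
        \<open>k\<close> is maximal.\<close>
      let ?z = "marginal_vector w \<epsilon>"
      have "jump i * ((\<Sum>l\<in>\<epsilon> ` {1..i}. y $ l) - (\<Sum>l\<in>\<epsilon> ` {1..i}. ?z $ l)) \<ge> 0"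
        if "i \<in> {1..<CARD('n)}" for i
        using jump[OF that] that core_ge[OF y, of "\<epsilon> ` {1..i}"]
          prefix_tight_marginal_vector[OF \<epsilon> supermodular_cone_empty[OF w], of i]
        by (intro mult_nonneg_nonneg) (auto simp: tightness_class_def)
      note nonneg = this
      have "0 \<le> x \<bullet> (y - ?z)"
        using x marginal_vector_in_core[OF \<epsilon> w] by (simp add: normal_cone_def)
      then have "(\<Sum>i=1..<CARD('n). jump i *
          ((\<Sum>l\<in>\<epsilon> ` {1..i}. y $ l) - (\<Sum>l\<in>\<epsilon> ` {1..i}. ?z $ l))) \<le> 0"
        unfolding parts[OF marginal_vector_in_core[OF \<epsilon> w]]
        by (simp add: right_diff_distrib sum_subtractf)
      then have "jump k * ((\<Sum>l\<in>\<epsilon> ` {1..k}. y $ l) - (\<Sum>l\<in>\<epsilon> ` {1..k}. ?z $ l)) = 0"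
        using nonneg 3 by (metis (no_types, lifting) antisym finite_atLeastLessThan
            sum_nonneg sum_nonneg_eq_0_iff)
      moreover have "jump k > 0" using ge[of "Suc k"] kt 3 by (force simp: jump_def)
      ultimately have "(\<Sum>l\<in>\<epsilon> ` {1..k}. y $ l) = (\<Sum>l\<in>\<epsilon> ` {1..k}. ?z $ l)" by simp
      then show ?thesis
        using prefix_tight_marginal_vector[OF \<epsilon> supermodular_cone_empty[OF w] kn]
        by (simp add: sub tightness_class_def)
    qed
  next
    assume tight: "\<forall>t. {u. x $ u \<le> t} \<in> tightness_class w y"
    have "0 \<le> x \<bullet> (y - z)" if z: "z \<in> core w" for z
      unfolding parts[OF z]
    proof (rule sum_nonneg)
      fix i assume i: "i \<in> {1..<CARD('n)}"
      show "0 \<le> jump i * ((\<Sum>l\<in>\<epsilon> ` {1..i}. z $ l) - (\<Sum>l\<in>\<epsilon> ` {1..i}. y $ l))"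
      proof (cases "jump i = 0")
        case False
        then have lt: "x $ \<epsilon> i < x $ \<epsilon> (Suc i)" using jump[OF i] by (simp add: jump_def)
        have "{u. x $ u \<le> x $ \<epsilon> i} = \<epsilon> ` {1..i}"
        proof (intro equalityI subsetI)
          fix u assume u: "u \<in> {u. x $ u \<le> x $ \<epsilon> i}"
          obtain j where j: "j < CARD('n)" "u = \<epsilon> (Suc j)" using enumeration_cases[OF \<epsilon>] .
          then have "\<not> Suc i \<le> Suc j" using mono[of "Suc i" "Suc j"] u lt by auto
          then show "u \<in> \<epsilon> ` {1..i}" using j by simp
        next
          fix u assume "u \<in> \<epsilon> ` {1..i}"
          then obtain j where "1 \<le> j" "j \<le> i" "u = \<epsilon> j" by auto
          then show "u \<in> {u. x $ u \<le> x $ \<epsilon> i}" using mono[of j i] i by simp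
        qed
        then have "\<epsilon> ` {1..i} \<in> tightness_class w y" using tight by metis
        then show ?thesis
          using jump[OF i] core_ge[OF z, of "\<epsilon> ` {1..i}"] by (simp add: tightness_class_def)
      qed simp
    qed
    then show "x \<in> normal_cone (core w) y" by (simp add: normal_cone_def)
  qed
qed

text \<open>The sublevel sets of the indicator of the complement of \<open>S\<close> are
  \<open>{}\<close>, \<open>S\<close> and \<open>UNIV\<close>, and the first and last are always
  tight in the core.\<close>

lemma tightness_class_eq_normal_cone:
  fixes w :: "real ^ ('n::finite set)"
  assumes y: "y \<in> core w" and w: "w \<in> supermodular_cone"
  shows "tightness_class w y = {S. (\<chi> u. if u \<in> S then 0 else 1) \<in> normal_cone (core w) y}"
proof -
  have "{} \<in> tightness_class w y" "UNIV \<in> tightness_class w y"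
    using core_total[OF y] supermodular_cone_empty[OF w] by (simp_all add: tightness_class_def)
  moreover have "{u. (if u \<in> S then 0 else 1 :: real) \<le> t} = (if t < 0 then {} else if t < 1 then S else UNIV)"
    for S :: "'n set" and t by auto
  ultimately have "S \<in> tightness_class w y \<longleftrightarrow>
      (\<forall>t. {u. (if u \<in> S then 0 else 1 :: real) \<le> t} \<in> tightness_class w y)" for S
    by (auto dest: spec[of _ 0])
  then show ?thesis
    unfolding mem_normal_cone_core_iff[OF y w] vec_lambda_beta by blast
qed

text \<open>All points of the core are taken, not only the vertices, to match the normal fan, which
  has a cone for every point.\<close>

definition core_tightness :: "real ^ ('n::finite set) \<Rightarrow> 'n set set set" where
  "core_tightness w = tightness_class w ` core w"

text \<open>Each object is the image of the other under a map independent of the game: sublevel sets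
  in one direction, indicator vectors in the other.\<close>

lemma normal_fan_core_eq_iff_core_tightness:
  assumes m: "m \<in> supermodular_cone" and r: "r \<in> supermodular_cone"
  shows "normal_fan (core m) = normal_fan (core r) \<longleftrightarrow> core_tightness m = core_tightness r"
proof -
  have fan: "normal_fan (core w) = (\<lambda>\<T>. {x. \<forall>t. {u. x $ u \<le> t} \<in> \<T>}) ` core_tightness w"
    if "w \<in> supermodular_cone" for w :: "real ^ 'a set"
  proof -
    have "normal_fan (core w) = normal_cone (core w) ` core w" by (auto simp: normal_fan_def)
    also have "\<dots> = (\<lambda>y. {x. \<forall>t. {u. x $ u \<le> t} \<in> tightness_class w y}) ` core w"
      using mem_normal_cone_core_iff[OF _ that] by (intro image_cong) auto
    finally show ?thesis by (simp add: core_tightness_def image_image)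
  qed
  have tight: "core_tightness w =
      (\<lambda>K. {S. (\<chi> u. if u \<in> S then 0 else 1) \<in> K}) ` normal_fan (core w)"
    if "w \<in> supermodular_cone" for w :: "real ^ 'a set"
  proof -
    have "normal_fan (core w) = normal_cone (core w) ` core w" by (auto simp: normal_fan_def)
    then show ?thesis
      unfolding core_tightness_def using tightness_class_eq_normal_cone[OF _ that]
      by (simp add: image_image)
  qed
  show ?thesis
  proof
    assume "normal_fan (core m) = normal_fan (core r)"
    then show "core_tightness m = core_tightness r" by (simp only: tight[OF m] tight[OF r])
  next
    assume "core_tightness m = core_tightness r"
    then show "normal_fan (core m) = normal_fan (core r)" by (simp only: fan[OF m] fan[OF r])
  qed
qed

text \<open>The excess at the combination is the weighted sum of the excesses at the
  \<open>p i\<close>, all nonnegative in the core, so it vanishes iff every excess with nonzero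
  weight does.\<close>

lemma tightness_class_convex_combination:
  assumes I: "finite I" and p: "\<And>i. i \<in> I \<Longrightarrow> p i \<in> core w"
    and c: "\<And>i. i \<in> I \<Longrightarrow> 0 \<le> c i" "sum c I = 1"
  shows "tightness_class w (\<Sum>i\<in>I. c i *\<^sub>R p i) =
    {S. \<forall>i\<in>I. c i \<noteq> 0 \<longrightarrow> S \<in> tightness_class w (p i)}"
proof -
  have "S \<in> tightness_class w (\<Sum>i\<in>I. c i *\<^sub>R p i) \<longleftrightarrow>
      (\<forall>i\<in>I. c i \<noteq> 0 \<longrightarrow> S \<in> tightness_class w (p i))" for S
  proof -
    have "(\<Sum>l\<in>S. (\<Sum>i\<in>I. c i *\<^sub>R p i) $ l) = (\<Sum>i\<in>I. c i * (\<Sum>l\<in>S. p i $ l))"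
      by (simp add: sum_distrib_left sum.swap[of _ S])
    moreover have "w $ S = (\<Sum>i\<in>I. c i * w $ S)" using c(2) by (simp flip: sum_distrib_right)
    ultimately have "S \<in> tightness_class w (\<Sum>i\<in>I. c i *\<^sub>R p i) \<longleftrightarrow>
        (\<Sum>i\<in>I. c i * ((\<Sum>l\<in>S. p i $ l) - w $ S)) = 0"
      by (simp add: tightness_class_def right_diff_distrib sum_subtractf)
    also have "\<dots> \<longleftrightarrow> (\<forall>i\<in>I. c i * ((\<Sum>l\<in>S. p i $ l) - w $ S) = 0)"
      using I c core_ge[OF p] by (intro sum_nonneg_eq_0_iff) (auto intro!: mult_nonneg_nonneg)
    finally show ?thesis by (auto simp: tightness_class_def)
  qed
  then show ?thesis by blast
qed

text \<open>
  Replacing the vertices of \<open>core m\<close> by those of \<open>core r\<close> in a convex combination does not change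
  its tight sets.
\<close>

lemma core_tightness_subset:
  assumes m: "m \<in> supermodular_cone" and r: "r \<in> supermodular_cone"
    and eq: "independence_structure m = independence_structure r"
  shows "core_tightness m \<subseteq> core_tightness r"
proof
  fix \<T> assume "\<T> \<in> core_tightness m"
  then obtain y where y: "y \<in> core m" and \<T>: "\<T> = tightness_class m y"
    by (auto simp: core_tightness_def)
  define V where "V = marginal_vector m ` enumerations"
  have fin: "finite V" by (simp add: V_def finite_enumerations)
  have Vm: "V \<subseteq> core m" using marginal_vector_in_core[OF _ m] by (auto simp: V_def)
  obtain c where c: "\<And>v. v \<in> V \<Longrightarrow> 0 \<le> c v" "sum c V = 1" and yc: "(\<Sum>v\<in>V. c v *\<^sub>R v) = y"
    using y unfolding core_eq_convex_hull[OF m] V_def[symmetric] convex_hull_finite[OF fin] by blast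
  \<comment> \<open>Sends a marginal vector of \<open>m\<close> to one of \<open>r\<close> at the
    same enumeration. Any enumeration in the fibre may be chosen: the tightness classes at
    \<open>v\<close> and \<open>g v\<close> agree.\<close>
  define g where "g v = marginal_vector r (SOME \<epsilon>. \<epsilon> \<in> enumerations \<and> marginal_vector m \<epsilon> = v)"
    for v
  have g: "g v \<in> core r \<and> tightness_class m v = tightness_class r (g v)" if "v \<in> V" for v
  proof -
    define \<epsilon> where "\<epsilon> = (SOME \<epsilon>. \<epsilon> \<in> enumerations \<and> marginal_vector m \<epsilon> = v)"
    have "\<exists>\<epsilon>. \<epsilon> \<in> enumerations \<and> marginal_vector m \<epsilon> = v" using that by (auto simp: V_def)
    then have \<epsilon>: "\<epsilon> \<in> enumerations \<and> marginal_vector m \<epsilon> = v" unfolding \<epsilon>_def by (rule someI_ex)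
    have "g v = marginal_vector r \<epsilon>" by (simp add: g_def \<epsilon>_def)
    then show ?thesis
      using \<epsilon> marginal_vector_in_core[OF _ r] tightness_class_marginal_vector_eq[OF m r eq] by auto
  qed
  have "tightness_class m y = tightness_class r (\<Sum>v\<in>V. c v *\<^sub>R g v)"
    using tightness_class_convex_combination[OF fin _ c, of "\<lambda>v. v" m] Vm
      tightness_class_convex_combination[OF fin _ c, of g r] g unfolding yc by auto
  moreover have "(\<Sum>v\<in>V. c v *\<^sub>R g v) \<in> core r"
    using g by (intro convex_sum fin convex_core c) auto
  ultimately show "\<T> \<in> core_tightness r" by (auto simp: core_tightness_def \<T>)
qed

lemma normal_fan_core_eq_iff:
  assumes m: "m \<in> supermodular_cone" and r: "r \<in> supermodular_cone"
  shows "normal_fan (core m) = normal_fan (core r) \<longleftrightarrow>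
    independence_structure m = independence_structure r"
  unfolding normal_fan_core_eq_iff_core_tightness[OF m r]
proof
  assume "core_tightness m = core_tightness r"
  then have "\<exists>y. tightness_class m (marginal_vector m \<epsilon>) = tightness_class r y"
    if "\<epsilon> \<in> enumerations" for \<epsilon>
    using marginal_vector_in_core[OF that m] unfolding core_tightness_def by blast
  then show "independence_structure m = independence_structure r"
    by (rule independence_structure_eq_if_tight[OF m r])
next
  assume "independence_structure m = independence_structure r"
  then show "core_tightness m = core_tightness r"
    using core_tightness_subset[OF m r] core_tightness_subset[OF r m] by simp
qed

theorem corollary18:
  fixes m r :: "real ^ ('n::finite set)"
  assumes "m \<in> supermodular_cone" and "r \<in> supermodular_cone"
  shows "(generated_face supermodular_cone m = generated_face supermodular_cone r \<longleftrightarrow>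
            independence_structure m = independence_structure r) \<and>
         (generated_face supermodular_cone m = generated_face supermodular_cone r \<longleftrightarrow>
            permutohedral_subgraph m = permutohedral_subgraph r) \<and>
         (generated_face supermodular_cone m = generated_face supermodular_cone r \<longleftrightarrow>
            enumeration_partition m = enumeration_partition r) \<and>
         (generated_face supermodular_cone m = generated_face supermodular_cone r \<longleftrightarrow>
            fan_of_posets m = fan_of_posets r) \<and>
         (generated_face supermodular_cone m = generated_face supermodular_cone r \<longleftrightarrow>
            tightness_structure m = tightness_structure r) \<and>
         (generated_face supermodular_cone m = generated_face supermodular_cone r \<longleftrightarrow>
            normal_fan (core m) = normal_fan (core r))"
  unfolding generated_face_eq_iff_independence_structure[OF assms]
    permutohedral_subgraph_eq_iff[OF assms] enumeration_partition_eq_iff[OF assms]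
    fan_of_posets_eq_iff[OF assms] tightness_structure_eq_iff[OF assms]
    normal_fan_core_eq_iff[OF assms]
  by simp

end
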